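(* For two Banach lattices $E$ and $F$ the following assertions are equivalent: (1) Every positive operator from $E$ into $F$ dominated by a PL-compact operator is PL-compact (i.e., whenever $S,T:E\to F$ are positive operators with $0\le S\le T$ and $T$ is PL-compact, $S$ is PL-compact). (2) One of the following two conditions holds: (a) the norm of the dual $E'$ is order continuous; (b) every order interval in $F$ is $|\sigma|(F,F')$-totally bounded.
   Context: The absolute weak topology $|\sigma|(F,F')$ on a Banach lattice $F$ is the locally convex-solid topology generated by the lattice seminorms $p_f(x)=|f|(|x|)$, $f\in F'$. A set $A\subset F$ is $|\sigma|(F,F')$-totally bounded if for every $\varepsilon>0$ and every finite collection $\{f_1,\dots,f_n\}\subset F'$ there is a finite subset $\Phi\subset A$ with $A\subset \Phi+\bigcap_{i=1}^n\{x\in F:|f_i|(|x|)<\varepsilon\}$. A bounded linear operator $T:X\to F$ from a Banach space $X$ with closed unit ball $B_X$ to a Banach lattice $F$ is PL-compact if $T(B_X)$ is $|\sigma|(F,F')$-totally bounded in $F$. *)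

theory Defs
  imports "HOL-Analysis.Analysis" "HOL-Library.Lattice_Algebras" "HOL-Library.Set_Algebras"
begin

section \<open>Banach lattices\<close>

class banach_lattice = banach + ordered_real_vector + lattice_ab_group_add_abs +
  assumes norm_mono_abs: "\<bar>x\<bar> \<le> \<bar>y\<bar> \<Longrightarrow> norm x \<le> norm y"

instance real :: banach_lattice
  by standard simp

text \<open>A decreasing net is rendered by its range, a downward directed set \<open>D\<close>, which is then
  regarded as a net indexed by itself.\<close>

definition order_continuous_norm :: "'a::banach_lattice itself \<Rightarrow> bool" where
  "order_continuous_norm _ \<longleftrightarrow>
    (\<forall>D::'a set. D \<noteq> {} \<and> (\<forall>x\<in>D. \<forall>y\<in>D. \<exists>z\<in>D. z \<le> x \<and> z \<le> y) \<and>
        (\<forall>x\<in>D. 0 \<le> x) \<and> (\<forall>l. (\<forall>x\<in>D. l \<le> x) \<longrightarrow> l \<le> 0) \<longrightarrow>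
      (\<forall>\<epsilon>>0. \<exists>x\<in>D. \<forall>y\<in>D. y \<le> x \<longrightarrow> norm y < \<epsilon>))"


section \<open>The order on bounded operators and the dual Banach lattice\<close>

instantiation blinfun :: (banach_lattice, banach_lattice) ordered_real_vector
begin

definition less_eq_blinfun :: "'a \<Rightarrow>\<^sub>L 'b \<Rightarrow> 'a \<Rightarrow>\<^sub>L 'b \<Rightarrow> bool" where
  "S \<le> T \<longleftrightarrow> (\<forall>x\<ge>0. blinfun_apply S x \<le> blinfun_apply T x)"

definition less_blinfun :: "'a \<Rightarrow>\<^sub>L 'b \<Rightarrow> 'a \<Rightarrow>\<^sub>L 'b \<Rightarrow> bool" where
  "S < T \<longleftrightarrow> S \<le> T \<and> \<not> T \<le> (S :: 'a \<Rightarrow>\<^sub>L 'b)"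

instance
proof
  fix S T U :: "'a \<Rightarrow>\<^sub>L 'b" and a b :: real
  show "S < T \<longleftrightarrow> S \<le> T \<and> \<not> T \<le> S" by (rule less_blinfun_def)
  show "S \<le> S" by (simp add: less_eq_blinfun_def)
  show "S \<le> T \<Longrightarrow> T \<le> U \<Longrightarrow> S \<le> U"
    unfolding less_eq_blinfun_def by (meson order_trans)
  show "S = T" if "S \<le> T" "T \<le> S"
  proof (rule blinfun_eqI)
    have pos: "blinfun_apply S x = blinfun_apply T x" if "0 \<le> x" for x :: 'a
      using \<open>S \<le> T\<close> \<open>T \<le> S\<close> that by (simp add: less_eq_blinfun_def order.antisym)
    fix x :: 'a
    have "x = pprt x - (- nprt x)" by (simp flip: prts)
    then show "blinfun_apply S x = blinfun_apply T x"
      using pos[of "pprt x"] pos[of "- nprt x"]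
      by (metis blinfun.diff_right neg_0_le_iff_le nprt_le_zero zero_le_pprt)
  qed
  show "S \<le> T \<Longrightarrow> U + S \<le> U + T"
    by (simp add: less_eq_blinfun_def blinfun.add_left)
  show "S \<le> T \<Longrightarrow> 0 \<le> a \<Longrightarrow> a *\<^sub>R S \<le> a *\<^sub>R T"
    by (simp add: less_eq_blinfun_def blinfun.scaleR_left scaleR_left_mono)
  show "a \<le> b \<Longrightarrow> 0 \<le> S \<Longrightarrow> a *\<^sub>R S \<le> b *\<^sub>R S"
    by (simp add: less_eq_blinfun_def blinfun.scaleR_left scaleR_right_mono)
qed

end

text \<open>Bounded operators form a Banach lattice under the operator norm only for special codomains.
  The auxiliary class \<open>real_line\<close> singles out the Banach lattice \<open>\<real>\<close> (its models are all isomorphic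
  to it), so that the dual \<open>'a \<Rightarrow>\<^sub>L real\<close> can be made a type class instance.\<close>

class real_line = banach_lattice + conditionally_complete_linorder + real_normed_algebra_1 +
  assumes abs_eq_norm: "\<bar>x\<bar> = norm x *\<^sub>R 1"

instance real :: real_line
  by standard simp

type_synonym 'a dual = "'a \<Rightarrow>\<^sub>L real"

lemma blinfun_le_norm:
  fixes f :: "'a::banach_lattice \<Rightarrow>\<^sub>L 'b::real_line"
  assumes "norm x \<le> c"
  shows "blinfun_apply f x \<le> (norm f * c) *\<^sub>R 1"
proof -
  have one: "(0::'b) \<le> 1" using abs_eq_norm[of "1::'b"] by (metis abs_ge_zero norm_one scaleR_one)
  have "blinfun_apply f x \<le> norm (blinfun_apply f x) *\<^sub>R 1"
    by (metis abs_eq_norm abs_ge_self)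
  also have "\<dots> \<le> (norm f * c) *\<^sub>R 1"
    using assms norm_blinfun[of f x]
    by (intro scaleR_right_mono one) (meson mult_left_mono norm_ge_zero order_trans)
  finally show ?thesis .
qed

lemma riesz_kantorovich_pprt:
  fixes f :: "'a::banach_lattice \<Rightarrow>\<^sub>L 'b::real_line"
  shows "\<exists>h. (\<forall>x\<ge>0. blinfun_apply h x = (SUP y\<in>{0..x}. blinfun_apply f y)) \<and>
    (\<forall>x. bdd_above (blinfun_apply f ` {0..x}))"
proof -
  define P where "P x = (SUP y\<in>{0..x}. blinfun_apply f y)" for x
  have norm_mono: "norm y \<le> norm x" if "0 \<le> y" "y \<le> x" for x y :: 'a
    using that by (intro norm_mono_abs) simp
  have bdd: "bdd_above (blinfun_apply f ` {0..x})" for x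
    by (rule bdd_aboveI2[where M = "(norm f * norm x) *\<^sub>R 1"])
      (auto intro!: blinfun_le_norm norm_mono)
  have upper: "blinfun_apply f y \<le> P x" if "0 \<le> y" "y \<le> x" for x y
    unfolding P_def using that bdd by (intro cSUP_upper) auto
  have least: "P x \<le> c" if "0 \<le> x" "\<And>y. 0 \<le> y \<Longrightarrow> y \<le> x \<Longrightarrow> blinfun_apply f y \<le> c" for x c
    unfolding P_def using that by (intro cSUP_least) auto
  have P0: "0 \<le> P x" if "0 \<le> x" for x
    using upper[of 0 x] that by (simp add: blinfun.zero_right)
  have Padd: "P (x + y) = P x + P y" if x: "0 \<le> x" and y: "0 \<le> y" for x y
  proof (rule order.antisym)
    show "P (x + y) \<le> P x + P y"
    proof (rule least)
      fix z assume z: "0 \<le> z" "z \<le> x + y"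
      have "z \<le> inf z x + y"
        using z y by (simp add: add_inf_distrib_right)
      then have "blinfun_apply f (inf z x) + blinfun_apply f (z - inf z x) \<le> P x + P y"
        using z x by (intro add_mono upper) (simp_all del: diff_inf_eq_sup add: diff_le_eq add.commute)
      then show "blinfun_apply f z \<le> P x + P y"
        by (simp del: diff_inf_eq_sup flip: blinfun.add_right)
    qed (use x y in simp)
    have "P x \<le> P (x + y) - P y"
    proof (rule least)
      fix a assume a: "0 \<le> a" "a \<le> x"
      have "P y \<le> P (x + y) - blinfun_apply f a"
      proof (rule least)
        fix b assume b: "0 \<le> b" "b \<le> y"
        have "blinfun_apply f (a + b) \<le> P (x + y)"
          using a b by (intro upper add_mono add_nonneg_nonneg)
        then show "blinfun_apply f b \<le> P (x + y) - blinfun_apply f a"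
          by (simp add: blinfun.add_right le_diff_eq add.commute)
      qed (rule y)
      then show "blinfun_apply f a \<le> P (x + y) - P y"
        by (simp add: le_diff_eq add.commute)
    qed (rule x)
    then show "P x + P y \<le> P (x + y)" by (simp add: le_diff_eq)
  qed
  have Pscale_le: "P (c *\<^sub>R x) \<le> c *\<^sub>R P x" if x: "0 \<le> x" and c: "0 < c" for x and c :: real
  proof (rule least)
    fix z assume z: "0 \<le> z" "z \<le> c *\<^sub>R x"
    have "inverse c *\<^sub>R z \<le> inverse c *\<^sub>R (c *\<^sub>R x)"
      using z c by (intro scaleR_left_mono) auto
    then have "blinfun_apply f (inverse c *\<^sub>R z) \<le> P x"
      using z c by (intro upper) (auto intro: scaleR_nonneg_nonneg)
    then have "c *\<^sub>R blinfun_apply f (inverse c *\<^sub>R z) \<le> c *\<^sub>R P x"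
      using c by (intro scaleR_left_mono) auto
    then show "blinfun_apply f z \<le> c *\<^sub>R P x"
      using c by (simp add: blinfun.scaleR_right)
  qed (use x c in \<open>auto intro: scaleR_nonneg_nonneg\<close>)
  have Pscale: "P (c *\<^sub>R x) = c *\<^sub>R P x" if x: "0 \<le> x" and c: "0 < c" for x and c :: real
  proof (rule order.antisym[OF Pscale_le[OF x c]])
    have "P (inverse c *\<^sub>R (c *\<^sub>R x)) \<le> inverse c *\<^sub>R P (c *\<^sub>R x)"
      using x c by (intro Pscale_le) (auto intro: scaleR_nonneg_nonneg)
    then have "c *\<^sub>R P x \<le> c *\<^sub>R (inverse c *\<^sub>R P (c *\<^sub>R x))"
      using c by (intro scaleR_left_mono) auto
    then show "c *\<^sub>R P x \<le> P (c *\<^sub>R x)" using c by simp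
  qed
  define H where "H x = P (pprt x) - P (- nprt x)" for x
  have H: "H (a - b) = P a - P b" if "0 \<le> a" "0 \<le> b" for a b
  proof -
    have "pprt (a - b) + b = a + (- nprt (a - b))"
      using prts[of "a - b"] by (simp add: algebra_simps)
    then have "P (pprt (a - b)) + P b = P a + P (- nprt (a - b))"
      using that by (metis Padd neg_0_le_iff_le nprt_le_zero zero_le_pprt)
    then show ?thesis by (simp add: H_def algebra_simps)
  qed
  have rep: "x = pprt x - (- nprt x)" for x :: 'a by (simp flip: prts)
  have nn: "0 \<le> - nprt x" for x :: 'a by simp
  have "bounded_linear H"
  proof (rule bounded_linear_intro)
    fix x y :: 'a
    have "(pprt x + pprt y) - (- nprt x + - nprt y) = (pprt x + nprt x) + (pprt y + nprt y)"
      by (simp add: algebra_simps)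
    then have "x + y = (pprt x + pprt y) - (- nprt x + - nprt y)"
      by (simp flip: prts)
    then have "H (x + y) = P (pprt x + pprt y) - P (- nprt x + - nprt y)"
      using H[of "pprt x + pprt y" "- nprt x + - nprt y"]
      by (metis add_nonneg_nonneg nn zero_le_pprt)
    also have "\<dots> = H x + H y"
      using Padd[OF zero_le_pprt zero_le_pprt, of x y] Padd[OF nn nn, of x y] by (simp add: H_def)
    finally show "H (x + y) = H x + H y" .
  next
    fix r :: real and x :: 'a
    consider "r = 0" | "r > 0" | "r < 0" by linarith
    then show "H (r *\<^sub>R x) = r *\<^sub>R H x"
    proof cases
      case 1 then show ?thesis using H[of 0 0] by simp
    next
      case 2
      have "r *\<^sub>R x = r *\<^sub>R pprt x - r *\<^sub>R (- nprt x)"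
        by (metis rep scaleR_diff_right)
      then have "H (r *\<^sub>R x) = P (r *\<^sub>R pprt x) - P (r *\<^sub>R (- nprt x))"
        using 2 H[of "r *\<^sub>R pprt x" "r *\<^sub>R (- nprt x)"]
        by (metis less_imp_le nn scaleR_nonneg_nonneg zero_le_pprt)
      then show ?thesis
        using 2 Pscale[OF zero_le_pprt, of r x] Pscale[OF nn, of r x]
        by (simp add: H_def scaleR_diff_right)
    next
      case 3
      have "r *\<^sub>R x = (- r) *\<^sub>R (- nprt x) - (- r) *\<^sub>R pprt x"
        by (subst prts[of x]) (simp add: algebra_simps)
      then have "H (r *\<^sub>R x) = P ((- r) *\<^sub>R (- nprt x)) - P ((- r) *\<^sub>R pprt x)"
        using 3 H[of "(- r) *\<^sub>R (- nprt x)" "(- r) *\<^sub>R pprt x"]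
        by (metis less_imp_le neg_0_less_iff_less nn scaleR_nonneg_nonneg zero_le_pprt)
      then show ?thesis
        using 3 Pscale[OF zero_le_pprt, of "- r" x] Pscale[OF nn, of "- r" x]
        by (simp add: H_def scaleR_diff_right)
    qed
  next
    fix x :: 'a
    let ?c = "(norm f * norm x) *\<^sub>R (1::'b)"
    have absp: "\<bar>pprt x\<bar> \<le> \<bar>x\<bar>" "\<bar>- nprt x\<bar> \<le> \<bar>x\<bar>"
      by (simp_all add: abs_prts[of x] del: abs_minus_cancel)
    have Pb: "P y \<le> ?c" if "0 \<le> y" "\<bar>y\<bar> \<le> \<bar>x\<bar>" for y
      using that by (intro least blinfun_le_norm norm_mono_abs) auto
    have "P (pprt x) \<le> ?c" "P (- nprt x) \<le> ?c"
      using Pb[OF zero_le_pprt absp(1)] Pb[OF nn absp(2)] by auto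
    moreover have "0 \<le> P (pprt x)" "0 \<le> P (- nprt x)" using P0 nn zero_le_pprt by blast+
    ultimately have "H x \<le> ?c" "- H x \<le> ?c"
      unfolding H_def by (simp_all add: diff_le_eq add_increasing2)
    then have "\<bar>H x\<bar> \<le> ?c" by (rule abs_leI)
    then have "norm (H x) \<le> norm ?c" by (intro norm_mono_abs) (meson abs_ge_self order_trans)
    then show "norm (H x) \<le> norm x * norm f" by (simp add: mult.commute)
  qed
  then have "blinfun_apply (Blinfun H) x = H x" for x by (simp add: bounded_linear_Blinfun_apply)
  moreover have "H x = P x" if "0 \<le> x" for x
    using H[OF that order_refl] H[OF order_refl order_refl] P0[OF order_refl] Padd[of 0 0] by simp
  ultimately show ?thesis
    using bdd by (intro exI[of _ "Blinfun H"]) (simp add: P_def)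
qed

lemma blinfun_pprt_exists:
  fixes f :: "'a::banach_lattice \<Rightarrow>\<^sub>L 'b::real_line"
  shows "\<exists>h. f \<le> h \<and> 0 \<le> h \<and> (\<forall>k. f \<le> k \<longrightarrow> 0 \<le> k \<longrightarrow> h \<le> k) \<and>
    (\<forall>x\<ge>0. blinfun_apply h x = (SUP y\<in>{0..x}. blinfun_apply f y))"
proof -
  obtain h where h: "\<And>x. 0 \<le> x \<Longrightarrow> blinfun_apply h x = (SUP y\<in>{0..x}. blinfun_apply f y)"
    and bdd: "\<And>x. bdd_above (blinfun_apply f ` {0..x})"
    using riesz_kantorovich_pprt[of f] by meson
  have ge: "blinfun_apply f y \<le> blinfun_apply h x" if "0 \<le> y" "y \<le> x" for x y
  proof -
    have "0 \<le> x" using that by (rule order_trans)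
    then show ?thesis using that bdd unfolding h[OF \<open>0 \<le> x\<close>] by (intro cSUP_upper) auto
  qed
  show ?thesis
  proof (intro exI[of _ h] conjI allI impI h)
    show "f \<le> h" by (simp add: less_eq_blinfun_def ge)
    show "0 \<le> h" using ge[OF order_refl] by (simp add: less_eq_blinfun_def blinfun.zero_right)
    fix k assume k: "f \<le> k" "0 \<le> k"
    show "h \<le> k" unfolding less_eq_blinfun_def
    proof (intro allI impI)
      fix x :: 'a assume x: "0 \<le> x"
      show "blinfun_apply h x \<le> blinfun_apply k x" unfolding h[OF x]
      proof (rule cSUP_least)
        fix y assume y: "y \<in> {0..x}"
        have "0 \<le> blinfun_apply k (x - y)" using k(2) y by (simp add: less_eq_blinfun_def)
        then have "blinfun_apply k y \<le> blinfun_apply k x" by (simp add: blinfun.diff_right)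
        moreover have "blinfun_apply f y \<le> blinfun_apply k y"
          using k(1) y by (simp add: less_eq_blinfun_def)
        ultimately show "blinfun_apply f y \<le> blinfun_apply k x" by (rule order_trans[rotated])
      qed (use x in auto)
    qed
  qed
qed

lemma blinfun_sup_exists:
  fixes f g :: "'a::banach_lattice \<Rightarrow>\<^sub>L 'b::real_line"
  shows "\<exists>!h. f \<le> h \<and> g \<le> h \<and> (\<forall>k. f \<le> k \<and> g \<le> k \<longrightarrow> h \<le> k)"
proof -
  obtain h where h: "f - g \<le> h" "0 \<le> h" "\<And>k. f - g \<le> k \<Longrightarrow> 0 \<le> k \<Longrightarrow> h \<le> k"
    using blinfun_pprt_exists[of "f - g"] by meson
  have "g + h \<le> k" if "f \<le> k" "g \<le> k" for k
    using h(3)[of "k - g"] that by (simp add: algebra_simps)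
  then have "f \<le> g + h \<and> g \<le> g + h \<and> (\<forall>k. f \<le> k \<and> g \<le> k \<longrightarrow> g + h \<le> k)"
    using h(1,2) by (simp add: algebra_simps)
  then show ?thesis by (blast intro: order.antisym)
qed

text \<open>The definite descriptions are the least upper and greatest lower bound for the pointwise
  order on the positive cone; they exist by the Riesz--Kantorovich formula.\<close>

instantiation blinfun :: (banach_lattice, real_line) banach_lattice
begin

definition sup_blinfun :: "'a \<Rightarrow>\<^sub>L 'b \<Rightarrow> 'a \<Rightarrow>\<^sub>L 'b \<Rightarrow> 'a \<Rightarrow>\<^sub>L 'b" where
  "sup f g = (THE h. f \<le> h \<and> g \<le> h \<and> (\<forall>k. f \<le> k \<and> g \<le> k \<longrightarrow> h \<le> k))"
    for f g :: "'a \<Rightarrow>\<^sub>L 'b"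

definition inf_blinfun :: "'a \<Rightarrow>\<^sub>L 'b \<Rightarrow> 'a \<Rightarrow>\<^sub>L 'b \<Rightarrow> 'a \<Rightarrow>\<^sub>L 'b" where
  "inf f g = (THE h. h \<le> f \<and> h \<le> g \<and> (\<forall>k. k \<le> f \<and> k \<le> g \<longrightarrow> k \<le> h))"
    for f g :: "'a \<Rightarrow>\<^sub>L 'b"

definition abs_blinfun :: "'a \<Rightarrow>\<^sub>L 'b \<Rightarrow> 'a \<Rightarrow>\<^sub>L 'b" where
  "\<bar>f\<bar> = sup f (- f)"
    for f :: "'a \<Rightarrow>\<^sub>L 'b"

instance
proof
  fix f g h :: "'a \<Rightarrow>\<^sub>L 'b"
  have sup: "f \<le> sup f g \<and> g \<le> sup f g \<and> (\<forall>k. f \<le> k \<and> g \<le> k \<longrightarrow> sup f g \<le> k)"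
    for f g :: "'a \<Rightarrow>\<^sub>L 'b"
    unfolding sup_blinfun_def by (rule theI'[OF blinfun_sup_exists])
  show "f \<le> sup f g" "g \<le> sup f g" using sup[of f g] by auto
  show "g \<le> f \<Longrightarrow> h \<le> f \<Longrightarrow> sup g h \<le> f" using sup[of g h] by auto
  have inf: "inf f g \<le> f \<and> inf f g \<le> g \<and> (\<forall>k. k \<le> f \<and> k \<le> g \<longrightarrow> k \<le> inf f g)"
    for f g :: "'a \<Rightarrow>\<^sub>L 'b"
    unfolding inf_blinfun_def
  proof (rule theI', rule ex_ex1I)
    show "\<exists>h. h \<le> f \<and> h \<le> g \<and> (\<forall>k. k \<le> f \<and> k \<le> g \<longrightarrow> k \<le> h)"
    proof (intro exI conjI allI impI)
      show "- sup (- f) (- g) \<le> f" "- sup (- f) (- g) \<le> g"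
        using sup[of "- f" "- g"] by (simp_all add: minus_le_iff)
      fix k assume "k \<le> f \<and> k \<le> g"
      then show "k \<le> - sup (- f) (- g)"
        using sup[of "- f" "- g"] by (metis le_minus_iff neg_le_iff_le)
    qed
  qed (blast intro: order.antisym)
  show "inf f g \<le> f" "inf f g \<le> g" using inf[of f g] by auto
  show "f \<le> g \<Longrightarrow> f \<le> h \<Longrightarrow> f \<le> inf g h" using inf[of g h] by auto
  show "\<bar>f\<bar> = sup f (- f)" by (rule abs_blinfun_def)
  assume le: "\<bar>f\<bar> \<le> \<bar>g\<bar>"
  have ub: "blinfun_apply \<bar>g\<bar> u \<le> (norm g * norm u) *\<^sub>R 1" if u: "0 \<le> u" for u
  proof -
    obtain p where p: "g - (- g) \<le> p" "0 \<le> p" "\<And>k. g - (- g) \<le> k \<Longrightarrow> 0 \<le> k \<Longrightarrow> p \<le> k"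
      and ap: "\<And>x. 0 \<le> x \<Longrightarrow> blinfun_apply p x = (SUP y\<in>{0..x}. blinfun_apply (g - (- g)) y)"
      using blinfun_pprt_exists[of "g - (- g)"] by meson
    have "g \<le> p - g" "- g \<le> p - g"
      using p(1,2) by (simp_all add: algebra_simps)
    then have "\<bar>g\<bar> \<le> p - g" using sup[of g "- g"] by (simp add: abs_blinfun_def)
    then have "blinfun_apply \<bar>g\<bar> u \<le> blinfun_apply p u - blinfun_apply g u"
      using u by (simp add: less_eq_blinfun_def blinfun.diff_left)
    also have "\<dots> \<le> (norm g * norm u) *\<^sub>R 1"
    proof -
      have "blinfun_apply p u \<le> (norm g * norm u) *\<^sub>R 1 + blinfun_apply g u"
        unfolding ap[OF u]
      proof (rule cSUP_least)
        fix y assume y: "y \<in> {0..u}"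
        have "\<bar>y + y - u\<bar> \<le> \<bar>u\<bar>"
          using y u by (intro abs_leI) (auto simp: algebra_simps intro: add_mono)
        then have "norm (y + y - u) \<le> norm u" by (rule norm_mono_abs)
        then have "blinfun_apply g (y + y - u) \<le> (norm g * norm u) *\<^sub>R 1"
          by (rule blinfun_le_norm)
        then show "blinfun_apply (g - - g) y \<le> (norm g * norm u) *\<^sub>R 1 + blinfun_apply g u"
          by (simp add: blinfun.add_right blinfun.diff_right blinfun.add_left diff_le_eq)
      qed (use u in auto)
      then show ?thesis by (simp add: diff_le_eq)
    qed
    finally show ?thesis .
  qed
  show "norm f \<le> norm g"
  proof (rule norm_blinfun_bound)
    fix x :: 'a
    have fa: "f \<le> \<bar>f\<bar>" "- f \<le> \<bar>f\<bar>" using sup[of f "- f"] by (auto simp: abs_blinfun_def)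
    have p: "blinfun_apply f y \<le> blinfun_apply \<bar>f\<bar> y" "- blinfun_apply f y \<le> blinfun_apply \<bar>f\<bar> y"
      if "0 \<le> y" for y
      using fa that by (simp_all add: less_eq_blinfun_def blinfun.minus_left)
    have nn: "0 \<le> - nprt x" by simp
    have x: "blinfun_apply F x = blinfun_apply F (pprt x) - blinfun_apply F (- nprt x)"
      "blinfun_apply F \<bar>x\<bar> = blinfun_apply F (pprt x) + blinfun_apply F (- nprt x)"
      for F :: "'a \<Rightarrow>\<^sub>L 'b"
      by (simp_all add: abs_prts flip: blinfun.diff_right blinfun.add_right prts)
    have "blinfun_apply f x \<le> blinfun_apply \<bar>f\<bar> \<bar>x\<bar>" "- blinfun_apply f x \<le> blinfun_apply \<bar>f\<bar> \<bar>x\<bar>"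
      unfolding x(1)[of f] x(2)[of "\<bar>f\<bar>"]
      using add_mono[OF p(1)[OF zero_le_pprt] p(2)[OF nn], of x]
        add_mono[OF p(2)[OF zero_le_pprt] p(1)[OF nn], of x]
      by (simp_all add: algebra_simps)
    then have "\<bar>blinfun_apply f x\<bar> \<le> blinfun_apply \<bar>f\<bar> \<bar>x\<bar>" by (rule abs_leI)
    also have "\<dots> \<le> blinfun_apply \<bar>g\<bar> \<bar>x\<bar>" using le by (simp add: less_eq_blinfun_def)
    also have "\<dots> \<le> (norm g * norm \<bar>x\<bar>) *\<^sub>R 1" by (rule ub) simp
    finally have "norm (blinfun_apply f x) \<le> norm ((norm g * norm \<bar>x\<bar>) *\<^sub>R (1::'b))"
      by (intro norm_mono_abs) (meson abs_ge_self order_trans)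
    moreover have "norm \<bar>x\<bar> \<le> norm x" by (rule norm_mono_abs) simp
    ultimately show "norm (blinfun_apply f x) \<le> norm g * norm x"
      by simp (meson mult_left_mono norm_ge_zero order_trans)
  qed simp
qed

end


section \<open>The absolute weak topology and PL-compact operators\<close>

definition abs_weakly_totally_bounded :: "'f::banach_lattice set \<Rightarrow> bool" where
  "abs_weakly_totally_bounded A \<longleftrightarrow>
    (\<forall>\<epsilon>>0. \<forall>G::'f dual set. finite G \<longrightarrow>
      (\<exists>\<Phi>. finite \<Phi> \<and> \<Phi> \<subseteq> A \<and>
        A \<subseteq> \<Phi> + (\<Inter>f\<in>G. {x. blinfun_apply \<bar>f\<bar> \<bar>x\<bar> < \<epsilon>})))"

definition PL_compact :: "('x::banach \<Rightarrow>\<^sub>L 'f::banach_lattice) \<Rightarrow> bool" where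
  "PL_compact T \<longleftrightarrow> abs_weakly_totally_bounded (blinfun_apply T ` cball 0 1)"

end

theory Submission
  imports Defs
begin

text \<open>For \<open>f \<ge> 0\<close> in \<open>F'\<close> total boundedness is tested with the single seminorm \<open>x \<mapsto> f \<bar>x\<bar>\<close>.

  Let \<open>0 \<le> S \<le> T\<close> with \<open>T\<close> PL-compact.  If order intervals of \<open>F\<close> are totally bounded, \<open>S\<close> maps the
  positive part of the ball into a small neighbourhood of some \<open>[0, u]\<close>, because \<open>T\<close> does.  If the
  norm of \<open>E'\<close> is order continuous, the ball of \<open>E\<close> is almost order bounded for \<open>f \<circ> T\<close>, which leaves
  the image under \<open>S\<close> of an order interval \<open>[0, u]\<close>.  There, choose decompositions \<open>u = \<Sum> u\<^sub>i\<close> and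
  \<open>f = \<Sum> f\<^sub>j\<close> almost maximising the energy \<open>\<Sum> f\<^sub>j (S u\<^sub>i)\<^sup>2 / f\<^sub>j (T u\<^sub>i)\<close>, which grows under refinement.
  Near the maximum, \<open>S\<close> is approximated by \<open>\<Sum> h\<^sub>i\<^sub>j T\<close> on the pieces, with constants \<open>h\<^sub>i\<^sub>j\<close>, and inherits
  total boundedness from \<open>T\<close>.

  Conversely, if the norm of \<open>E'\<close> is not order continuous and \<open>[0, y]\<close> is not totally bounded,
  decreasing functionals \<open>d\<^sub>n\<close> that are bounded away from \<open>0\<close> in norm, but pointwise as small as
  desired, give the rank one operator \<open>T x = d\<^sub>0 x \<cdot> y\<close>, which dominates the non-PL-compact operator
  \<open>S x = \<Sum> (d\<^sub>n - d\<^sub>n\<^sub>+\<^sub>1) x \<cdot> y\<^sub>n\<close> for a suitable sequence in \<open>[0, y]\<close>.\<close>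

section \<open>Positive operators and functionals\<close>

lemma blinfun_nonneg: "0 \<le> f \<Longrightarrow> 0 \<le> x \<Longrightarrow> 0 \<le> blinfun_apply f x"
  for f :: "'a::banach_lattice \<Rightarrow>\<^sub>L 'b::banach_lattice"
  by (simp add: less_eq_blinfun_def)

lemma blinfun_mono: "0 \<le> f \<Longrightarrow> x \<le> y \<Longrightarrow> blinfun_apply f x \<le> blinfun_apply f y"
  for f :: "'a::banach_lattice \<Rightarrow>\<^sub>L 'b::banach_lattice"
  using blinfun_nonneg[of f "y - x"] by (simp add: blinfun.diff_right)

lemma blinfun_mono_left: "f \<le> g \<Longrightarrow> 0 \<le> x \<Longrightarrow> blinfun_apply f x \<le> blinfun_apply g x"
  for f :: "'a::banach_lattice \<Rightarrow>\<^sub>L 'b::banach_lattice"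
  by (simp add: less_eq_blinfun_def)

lemma norm_abs_lattice [simp]: "norm \<bar>x\<bar> = norm x" for x :: "'a::banach_lattice"
  by (intro order.antisym norm_mono_abs) simp_all

lemma norm_mono_nonneg: "0 \<le> x \<Longrightarrow> x \<le> y \<Longrightarrow> norm x \<le> norm y" for x :: "'a::banach_lattice"
  by (intro norm_mono_abs) simp

lemma pprt_eq_diff: "pprt x - pprt (- x) = x" for x :: "'a::banach_lattice"
  by (metis pprt_neg diff_minus_eq_add prts)

lemma abs_eq_pprt: "\<bar>x\<bar> = pprt x + pprt (- x)" for x :: "'a::banach_lattice"
  by (simp add: abs_prts pprt_neg)

lemma norm_pprt_le: "norm (pprt x) \<le> norm x" for x :: "'a::banach_lattice"
proof -
  have "pprt x \<le> \<bar>x\<bar>" by (simp add: abs_eq_pprt)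
  from norm_mono_nonneg[OF zero_le_pprt this] show ?thesis by simp
qed

lemma abs_blinfun_apply_le:
  fixes f :: "'a::banach_lattice \<Rightarrow>\<^sub>L 'b::banach_lattice"
  assumes "0 \<le> f"
  shows "\<bar>blinfun_apply f x\<bar> \<le> blinfun_apply f \<bar>x\<bar>"
proof (rule abs_leI)
  show "blinfun_apply f x \<le> blinfun_apply f \<bar>x\<bar>"
    by (rule blinfun_mono[OF assms]) (rule abs_ge_self)
  have "blinfun_apply f (- x) \<le> blinfun_apply f \<bar>x\<bar>"
    by (rule blinfun_mono[OF assms]) (rule abs_ge_minus_self)
  then show "- blinfun_apply f x \<le> blinfun_apply f \<bar>x\<bar>" by (simp add: blinfun.minus_right)
qed

lemma functional_le_norm: "blinfun_apply f x \<le> norm f * norm x" for f :: "'a::banach_lattice dual"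
  using norm_blinfun[of f x] by simp

text \<open>Since \<open>\<bar>d x\<bar> \<le> d \<bar>x\<bar>\<close>, the positive vectors of the
  ball determine the norm of \<open>d\<close>. Halving \<open>e\<close> gives a strict inequality
  even where the norm is not attained.\<close>

lemma positive_functional_norm_attained:
  fixes d :: "'a::banach_lattice dual"
  assumes d: "0 \<le> d" and e: "0 < e" "e \<le> norm d"
  shows "\<exists>x\<ge>0. norm x \<le> 1 \<and> e / 2 < blinfun_apply d x"
proof (rule ccontr)
  assume neg: "\<not> ?thesis"
  have "norm d \<le> e / 2"
  proof (rule norm_blinfun_bound)
    fix x
    show "norm (blinfun_apply d x) \<le> e / 2 * norm x"
    proof (cases "norm x = 0")
      case False
      have "0 \<le> inverse (norm x) *\<^sub>R \<bar>x\<bar>" by (rule scaleR_nonneg_nonneg) auto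
      moreover have "norm (inverse (norm x) *\<^sub>R \<bar>x\<bar>) \<le> 1" using False by simp
      ultimately have "blinfun_apply d (inverse (norm x) *\<^sub>R \<bar>x\<bar>) \<le> e / 2"
        using neg by force
      then have "blinfun_apply d \<bar>x\<bar> \<le> e / 2 * norm x"
        using False by (simp add: blinfun.scaleR_right field_simps)
      then show ?thesis using abs_blinfun_apply_le[OF d, of x] by simp
    qed auto
  qed (use e in simp)
  then show False using e by simp
qed

text \<open>The negative part of \<open>l\<close> is dominated by
  \<open>\<bar>z n - l\<bar>\<close>, so its norm is squeezed to 0.\<close>

lemma nonneg_tendsto:
  fixes z :: "nat \<Rightarrow> 'a::banach_lattice"
  assumes lim: "z \<longlonglongrightarrow> l" and z: "\<And>n. 0 \<le> z n"
  shows "0 \<le> l"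
proof -
  have "norm (pprt (- l)) \<le> norm (z n - l)" for n
  proof -
    have "- l \<le> z n - l" using z[of n] by simp
    then have "pprt (- l) \<le> \<bar>z n - l\<bar>"
      unfolding pprt_def by (meson abs_ge_self abs_ge_zero le_sup_iff order_trans)
    from norm_mono_nonneg[OF zero_le_pprt this] show ?thesis by simp
  qed
  moreover have "(\<lambda>n. norm (z n - l)) \<longlonglongrightarrow> 0"
    using lim by (simp add: LIM_zero tendsto_norm_zero)
  ultimately have "norm (pprt (- l)) \<le> 0"
    by (intro LIMSEQ_le_const) auto
  then have "pprt (- l) = 0" by simp
  then show ?thesis by (metis pprt_eq_diff diff_zero zero_le_pprt)
qed

lemma tendsto_le_lattice:
  fixes z w :: "nat \<Rightarrow> 'a::banach_lattice"
  assumes "z \<longlonglongrightarrow> l" "w \<longlonglongrightarrow> m" "\<And>n. z n \<le> w n"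
  shows "l \<le> m"
  using nonneg_tendsto[OF tendsto_diff[OF assms(2,1)]] assms(3) by simp

section \<open>Construction of positive functionals\<close>

text \<open>Values on the positive cone extend through \<open>x = pprt x - pprt (- x)\<close>, and
  domination by \<open>\<phi>\<close> makes the extension bounded. The inequality for scaling is an
  equality, by applying it to \<open>inverse c\<close> as well.\<close>

lemma positive_functional_extension:
  fixes P :: "'a::banach_lattice \<Rightarrow> real" and \<phi> :: "'a dual"
  assumes P: "\<And>x. 0 \<le> x \<Longrightarrow> 0 \<le> P x" "\<And>x. 0 \<le> x \<Longrightarrow> P x \<le> blinfun_apply \<phi> x"
    and Padd: "\<And>x y. 0 \<le> x \<Longrightarrow> 0 \<le> y \<Longrightarrow> P (x + y) = P x + P y"
    and Pscale: "\<And>c x. 0 < c \<Longrightarrow> 0 \<le> x \<Longrightarrow> P (c *\<^sub>R x) \<le> c * P x"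
  shows "\<exists>h. 0 \<le> h \<and> h \<le> \<phi> \<and> (\<forall>x\<ge>0. blinfun_apply h x = P x)"
proof -
  have Psc: "P (c *\<^sub>R x) = c * P x" if c: "0 < c" and x: "0 \<le> x" for c x
  proof (rule order.antisym[OF Pscale[OF that]])
    have "P (inverse c *\<^sub>R (c *\<^sub>R x)) \<le> inverse c * P (c *\<^sub>R x)"
      using c x by (intro Pscale) (auto intro: scaleR_nonneg_nonneg)
    then show "c * P x \<le> P (c *\<^sub>R x)" using c by (simp add: field_simps)
  qed
  define H where "H x = P (pprt x) - P (pprt (- x))" for x
  have H: "H (a - b) = P a - P b" if "0 \<le> a" "0 \<le> b" for a b
  proof -
    have "pprt (a - b) + b = a + pprt (- (a - b))"
      using pprt_eq_diff[of "a - b"] by (simp add: algebra_simps)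
    then have "P (pprt (a - b)) + P b = P a + P (pprt (- (a - b)))"
      using that Padd by (metis zero_le_pprt)
    then show ?thesis by (simp add: H_def)
  qed
  have "bounded_linear H"
  proof (rule bounded_linear_intro)
    fix x y :: 'a
    have "x + y = (pprt x + pprt y) - (pprt (- x) + pprt (- y))"
      using pprt_eq_diff[of x] pprt_eq_diff[of y] by (simp add: algebra_simps)
    then have "H (x + y) = P (pprt x + pprt y) - P (pprt (- x) + pprt (- y))"
      using H by (metis add_nonneg_nonneg zero_le_pprt)
    then show "H (x + y) = H x + H y" by (simp add: Padd H_def)
  next
    fix r :: real and x :: 'a
    consider "r = 0" | "r > 0" | "r < 0" by linarith
    then show "H (r *\<^sub>R x) = r *\<^sub>R H x"
    proof cases
      case 1 then show ?thesis using H[of 0 0] by simp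
    next
      case 2
      have "r *\<^sub>R x = r *\<^sub>R pprt x - r *\<^sub>R pprt (- x)"
        by (metis pprt_eq_diff scaleR_diff_right)
      then have "H (r *\<^sub>R x) = P (r *\<^sub>R pprt x) - P (r *\<^sub>R pprt (- x))"
        using 2 H by (metis less_imp_le scaleR_nonneg_nonneg zero_le_pprt)
      then show ?thesis using 2 Psc by (simp add: H_def algebra_simps)
    next
      case 3
      have "r *\<^sub>R x = (- r) *\<^sub>R pprt (- x) - (- r) *\<^sub>R pprt x"
        by (subst pprt_eq_diff[of x, symmetric]) (simp add: algebra_simps)
      then have "H (r *\<^sub>R x) = P ((- r) *\<^sub>R pprt (- x)) - P ((- r) *\<^sub>R pprt x)"
        using 3 H by (metis less_imp_le neg_0_less_iff_less scaleR_nonneg_nonneg zero_le_pprt)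
      then show ?thesis
        using 3 Psc[of "- r"] by (simp add: H_def algebra_simps del: scaleR_minus_left)
    qed
  next
    fix x :: 'a
    have "\<bar>H x\<bar> \<le> P (pprt x) + P (pprt (- x))"
      using P(1)[of "pprt x"] P(1)[of "pprt (- x)"] by (simp add: H_def)
    also have "\<dots> = P \<bar>x\<bar>" by (simp add: Padd abs_eq_pprt)
    also have "\<dots> \<le> norm \<phi> * norm x"
      using P(2)[of "\<bar>x\<bar>"] functional_le_norm[of \<phi> "\<bar>x\<bar>"] by simp
    finally show "norm (H x) \<le> norm x * norm \<phi>" by (simp add: mult.commute)
  qed
  then have "blinfun_apply (Blinfun H) x = H x" for x by (simp add: bounded_linear_Blinfun_apply)
  moreover have "H x = P x" if "0 \<le> x" for x
    using H[OF that order_refl] Padd[of 0 0] by simp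
  ultimately show ?thesis
    using P by (intro exI[of _ "Blinfun H"]) (simp add: less_eq_blinfun_def)
qed

text \<open>The infimum of a downward directed set is computed pointwise on the cone. Directedness
  gives additivity: near-minimisers at \<open>x\<close> and at \<open>y\<close> have a common lower
  bound in \<open>D\<close>, which is near-minimal at both.\<close>

lemma directed_functionals_inf:
  fixes D :: "'a::banach_lattice dual set"
  assumes ne: "D \<noteq> {}" and dir: "\<And>d e. d \<in> D \<Longrightarrow> e \<in> D \<Longrightarrow> \<exists>c\<in>D. c \<le> d \<and> c \<le> e"
    and D0: "\<And>d. d \<in> D \<Longrightarrow> 0 \<le> d"
  shows "\<exists>i. 0 \<le> i \<and> (\<forall>d\<in>D. i \<le> d) \<and>
    (\<forall>x\<ge>0. \<forall>e>0. \<exists>d\<in>D. blinfun_apply d x < blinfun_apply i x + e)"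
proof -
  define P where "P x = (INF d\<in>D. blinfun_apply d x)" for x
  have bdd: "bdd_below ((\<lambda>d. blinfun_apply d x) ` D)" if "0 \<le> x" for x
    using D0 that by (intro bdd_belowI2[where m = 0]) (simp add: less_eq_blinfun_def)
  have lower: "P x \<le> blinfun_apply d x" if "0 \<le> x" "d \<in> D" for x d
    unfolding P_def using that bdd by (intro cINF_lower)
  have great: "c \<le> P x" if "\<And>d. d \<in> D \<Longrightarrow> c \<le> blinfun_apply d x" for c x
    unfolding P_def using that ne by (intro cINF_greatest)
  have near: "\<exists>d\<in>D. blinfun_apply d x < P x + e" if "0 < e" for x e
  proof (rule ccontr)
    assume "\<not> ?thesis"
    then have "P x + e \<le> P x" by (intro great) auto
    then show False using that by simp
  qed
  obtain d0 where d0: "d0 \<in> D" using ne by blast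
  have "\<exists>h. 0 \<le> h \<and> h \<le> d0 \<and> (\<forall>x\<ge>0. blinfun_apply h x = P x)"
  proof (rule positive_functional_extension)
    show "0 \<le> P x" if "0 \<le> x" for x
      using D0 that by (intro great) (simp add: less_eq_blinfun_def)
    show "P x \<le> blinfun_apply d0 x" if "0 \<le> x" for x using lower that d0 by blast
    show "P (x + y) = P x + P y" if x: "0 \<le> x" and y: "0 \<le> y" for x y
    proof (rule order.antisym)
      show "P x + P y \<le> P (x + y)"
        by (rule great) (simp add: blinfun.add_right add_mono lower x y)
      show "P (x + y) \<le> P x + P y"
      proof (rule field_le_epsilon)
        fix e :: real assume e: "0 < e"
        obtain a b where ab: "a \<in> D" "blinfun_apply a x < P x + e / 2"
          "b \<in> D" "blinfun_apply b y < P y + e / 2"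
          using near[of "e / 2"] e by (meson half_gt_zero)
        then obtain c where c: "c \<in> D" "c \<le> a" "c \<le> b" using dir by blast
        have "P (x + y) \<le> blinfun_apply c x + blinfun_apply c y"
          using lower[of "x + y" c] c x y by (simp add: blinfun.add_right)
        also have "\<dots> \<le> blinfun_apply a x + blinfun_apply b y"
          using c x y by (intro add_mono) (auto simp: less_eq_blinfun_def)
        also have "\<dots> \<le> P x + P y + e" using ab by simp
        finally show "P (x + y) \<le> P x + P y + e" .
      qed
    qed
    show "P (c *\<^sub>R x) \<le> c * P x" if c: "0 < c" and x: "0 \<le> x" for c x
    proof -
      have "inverse c * P (c *\<^sub>R x) \<le> P x"
      proof (rule great)
        fix d assume "d \<in> D"
        then have "P (c *\<^sub>R x) \<le> c * blinfun_apply d x"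
          using lower[of "c *\<^sub>R x" d] c x by (simp add: scaleR_nonneg_nonneg blinfun.scaleR_right)
        then show "inverse c * P (c *\<^sub>R x) \<le> blinfun_apply d x" using c by (simp add: field_simps)
      qed
      then show ?thesis using c by (simp add: field_simps)
    qed
  qed
  then obtain h where h: "0 \<le> h" "\<And>x. 0 \<le> x \<Longrightarrow> blinfun_apply h x = P x" by blast
  show ?thesis
  proof (intro exI[of _ h] conjI ballI allI impI h(1))
    show "h \<le> d" if "d \<in> D" for d using that lower h by (simp add: less_eq_blinfun_def)
    show "\<exists>d\<in>D. blinfun_apply d x < blinfun_apply h x + e" if "0 \<le> x" "0 < e" for x e
      using near[of e x] h that by simp
  qed
qed

text \<open>Splitting at \<open>inf z x\<close> works because
  \<open>z \<le> inf (z + y) (x + y) = inf z x + y\<close>.\<close>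

lemma riesz_decomposition:
  fixes x y z :: "'a::banach_lattice"
  assumes "0 \<le> z" "z \<le> x + y" "0 \<le> x" "0 \<le> y"
  shows "0 \<le> inf z x" "inf z x \<le> x" "0 \<le> z - inf z x" "z - inf z x \<le> y"
proof -
  have "z \<le> inf z x + y" using assms by (simp add: add_inf_distrib_right)
  then show "z - inf z x \<le> y" by (simp add: diff_le_eq add.commute del: diff_inf_eq_sup)
qed (use assms in \<open>simp_all del: diff_inf_eq_sup\<close>)

text \<open>\<open>g\<close> is \<open>f\<close> cut down to the band generated by \<open>pprt y\<close>.\<close>

lemma functional_pprt_attained:
  fixes f :: "'a::banach_lattice dual"
  assumes f: "0 \<le> f"
  shows "\<exists>g. 0 \<le> g \<and> g \<le> f \<and> blinfun_apply g y = blinfun_apply f (pprt y)"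
proof -
  \<comment> \<open>The elements of \<open>{0..x}\<close> in the ideal generated by
    \<open>pprt y\<close>; the supremum of \<open>f\<close> over them will be the value of
    \<open>g\<close> at \<open>x\<close>.\<close>
  define A where "A x = {z. 0 \<le> z \<and> z \<le> x \<and> (\<exists>t\<ge>0. z \<le> t *\<^sub>R pprt y)}" for x
  define P where "P x = (SUP z\<in>A x. blinfun_apply f z)" for x
  have A0: "0 \<in> A x" if "0 \<le> x" for x using that by (auto simp: A_def intro: exI[of _ 0])
  have bdd: "bdd_above (blinfun_apply f ` A x)" for x
    by (rule bdd_aboveI2[where M = "blinfun_apply f x"]) (auto simp: A_def intro: blinfun_mono f)
  have upper: "blinfun_apply f z \<le> P x" if "z \<in> A x" for z x
    unfolding P_def using that bdd by (intro cSUP_upper)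
  have least: "P x \<le> c" if "0 \<le> x" "\<And>z. z \<in> A x \<Longrightarrow> blinfun_apply f z \<le> c" for x c
    unfolding P_def using A0[OF that(1)] that(2) by (intro cSUP_least) auto
  have "\<exists>h. 0 \<le> h \<and> h \<le> f \<and> (\<forall>x\<ge>0. blinfun_apply h x = P x)"
  proof (rule positive_functional_extension)
    show "0 \<le> P x" if "0 \<le> x" for x using upper[OF A0[OF that]] by (simp add: blinfun.zero_right)
    show "P x \<le> blinfun_apply f x" if "0 \<le> x" for x
      using that by (rule least) (auto simp: A_def intro: blinfun_mono f)
    show "P (x + x') = P x + P x'" if x: "0 \<le> x" and x': "0 \<le> x'" for x x'
    proof (rule order.antisym)
      show "P (x + x') \<le> P x + P x'"
      proof (rule least)
        fix z assume z: "z \<in> A (x + x')"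
        then obtain t where t: "0 \<le> t" "z \<le> t *\<^sub>R pprt y" by (auto simp: A_def)
        note r = riesz_decomposition[of z x x']
        have 1: "inf z x \<in> A x"
          using z x x' r t by (auto simp: A_def intro: le_infI1 exI[of _ t])
        have "z - inf z x \<le> z" using r(1) z x x' by (simp add: A_def del: diff_inf_eq_sup)
        then have 2: "z - inf z x \<in> A x'"
          using z x x' r t order_trans[of "z - inf z x" z]
          by (auto simp: A_def simp del: diff_inf_eq_sup intro!: exI[of _ t])
        show "blinfun_apply f z \<le> P x + P x'"
          using add_mono[OF upper[OF 1] upper[OF 2]] by (simp add: blinfun.diff_right del: diff_inf_eq_sup)
      qed (use x x' in simp)
      have "P x \<le> P (x + x') - P x'"
      proof (rule least)
        fix a assume a: "a \<in> A x"
        have "P x' \<le> P (x + x') - blinfun_apply f a"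
        proof (rule least)
          fix b assume b: "b \<in> A x'"
          obtain s t where "0 \<le> s" "a \<le> s *\<^sub>R pprt y" "0 \<le> t" "b \<le> t *\<^sub>R pprt y"
            using a b by (auto simp: A_def)
          then have "\<exists>t\<ge>0. a + b \<le> t *\<^sub>R pprt y"
            by (intro exI[of _ "s + t"]) (simp add: scaleR_left_distrib add_mono)
          then have "a + b \<in> A (x + x')" using a b by (simp add: A_def add_mono)
          then show "blinfun_apply f b \<le> P (x + x') - blinfun_apply f a"
            using upper[of "a + b" "x + x'"] by (simp add: blinfun.add_right)
        qed (rule x')
        then show "blinfun_apply f a \<le> P (x + x') - P x'" by simp
      qed (rule x)
      then show "P x + P x' \<le> P (x + x')" by simp
    qed
    show "P (c *\<^sub>R x) \<le> c * P x" if c: "0 < c" and x: "0 \<le> x" for c x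
    proof (rule least)
      fix z assume z: "z \<in> A (c *\<^sub>R x)"
      then obtain t where t: "0 \<le> t" "z \<le> t *\<^sub>R pprt y" by (auto simp: A_def)
      have i: "inverse c *\<^sub>R z \<le> inverse c *\<^sub>R w" if "z \<le> w" for w
        using that c by (intro scaleR_left_mono) auto
      have "\<exists>t\<ge>0. inverse c *\<^sub>R z \<le> t *\<^sub>R pprt y"
        using i[OF t(2)] t(1) c by (intro exI[of _ "inverse c * t"]) simp
      then have "inverse c *\<^sub>R z \<in> A x"
        using i[of "c *\<^sub>R x"] z c by (auto simp: A_def intro: scaleR_nonneg_nonneg)
      then have "inverse c * blinfun_apply f z \<le> P x"
        using upper by (fastforce simp: blinfun.scaleR_right)
      then show "blinfun_apply f z \<le> c * P x" using c by (simp add: field_simps)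
    qed (use x c in \<open>auto intro: scaleR_nonneg_nonneg\<close>)
  qed
  then obtain g where g: "0 \<le> g" "g \<le> f" "\<And>x. 0 \<le> x \<Longrightarrow> blinfun_apply g x = P x" by blast
  have "pprt y \<in> A (pprt y)" by (auto simp: A_def intro: exI[of _ 1])
  from upper[OF this] have "blinfun_apply g (pprt y) = blinfun_apply f (pprt y)"
    using blinfun_mono_left[OF g(2), of "pprt y"] g(3)[of "pprt y"] by simp
  moreover have "blinfun_apply g (pprt (- y)) = 0"
  proof -
    have "P (pprt (- y)) \<le> 0"
    proof (rule least)
      fix z assume "z \<in> A (pprt (- y))"
      then obtain t where z: "0 \<le> z" "z \<le> pprt (- y)" and t: "0 \<le> t" "z \<le> t *\<^sub>R pprt y"
        by (auto simp: A_def)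
      \<comment> \<open>As \<open>?s \<ge> t\<close>, scaling by \<open>inverse ?s\<close> brings
        \<open>z\<close> below \<open>pprt y\<close>; as \<open>?s \<ge> 1\<close>, it keeps
        \<open>z\<close> below \<open>pprt (- y)\<close>. These two are disjoint, so
        \<open>z = 0\<close>.\<close>
      let ?s = "max 1 t"
      have d: "inf (pprt y) (pprt (- y)) = 0"
      proof -
        have "pprt (- y) = pprt y + (- y)" using pprt_eq_diff[of y] by (simp add: algebra_simps)
        then have "inf (pprt y) (pprt (- y)) = pprt y + inf 0 (- y)"
          by (simp add: add_inf_distrib_left)
        also have "inf 0 (- y) = - pprt y" by (metis nprt_def nprt_neg inf.commute)
        finally show ?thesis by simp
      qed
      have "inverse ?s *\<^sub>R z \<le> pprt y"
      proof -
        have "z \<le> ?s *\<^sub>R pprt y"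
          using t(2) scaleR_right_mono[of t ?s "pprt y"] by (meson max.cobounded2 order_trans zero_le_pprt)
        then have "inverse ?s *\<^sub>R z \<le> inverse ?s *\<^sub>R (?s *\<^sub>R pprt y)"
          by (intro scaleR_left_mono) auto
        then show ?thesis by simp
      qed
      moreover have "inverse ?s *\<^sub>R z \<le> pprt (- y)"
      proof -
        have "inverse ?s *\<^sub>R z \<le> 1 *\<^sub>R z"
          using z by (intro scaleR_right_mono) (auto simp: field_simps)
        then show ?thesis using z(2) by simp
      qed
      ultimately have "inverse ?s *\<^sub>R z \<le> 0" using d by (metis le_inf_iff)
      then have "?s *\<^sub>R (inverse ?s *\<^sub>R z) \<le> ?s *\<^sub>R 0" by (intro scaleR_left_mono) auto
      then have "z = 0" using z by simp
      then show "blinfun_apply f z \<le> 0" by (simp add: blinfun.zero_right)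
    qed simp
    then show ?thesis using g(3)[of "pprt (- y)"] blinfun_nonneg[OF g(1), of "pprt (- y)"] by simp
  qed
  ultimately have "blinfun_apply g y = blinfun_apply f (pprt y)"
    by (metis pprt_eq_diff blinfun.diff_right diff_zero)
  then show ?thesis using g by blast
qed

section \<open>Total boundedness for the seminorm of a functional\<close>

lemma functional_abs_triangle:
  fixes f :: "'a::banach_lattice dual"
  assumes "0 \<le> f"
  shows "blinfun_apply f \<bar>x + y\<bar> \<le> blinfun_apply f \<bar>x\<bar> + blinfun_apply f \<bar>y\<bar>"
  using blinfun_mono[OF assms abs_triangle_ineq[of x y]] by (simp add: blinfun.add_right)

lemma functional_abs_diff_triangle:
  fixes f :: "'a::banach_lattice dual"
  assumes "0 \<le> f"
  shows "blinfun_apply f \<bar>x - z\<bar> \<le> blinfun_apply f \<bar>x - y\<bar> + blinfun_apply f \<bar>z - y\<bar>"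
  using functional_abs_triangle[OF assms, of "x - y" "y - z"] by (simp add: abs_minus_commute)

definition seminorm_totally_bounded :: "'a::banach_lattice dual \<Rightarrow> 'a set \<Rightarrow> bool" where
  "seminorm_totally_bounded f A \<longleftrightarrow>
    (\<forall>e>0. \<exists>\<Phi>. finite \<Phi> \<and> \<Phi> \<subseteq> A \<and> (\<forall>x\<in>A. \<exists>y\<in>\<Phi>. blinfun_apply f \<bar>x - y\<bar> < e))"

text \<open>The seminorms of a finite set \<open>G\<close> are all dominated by that of the single
  positive functional \<open>\<Sum>g\<in>G. \<bar>g\<bar>\<close>.\<close>

lemma abs_weakly_totally_bounded_iff:
  fixes A :: "'a::banach_lattice set"
  shows "abs_weakly_totally_bounded A \<longleftrightarrow> (\<forall>f\<ge>0. seminorm_totally_bounded f A)"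
proof (intro iffI allI impI)
  fix f :: "'a dual"
  assume A: "abs_weakly_totally_bounded A" and f: "0 \<le> f"
  show "seminorm_totally_bounded f A" unfolding seminorm_totally_bounded_def
  proof (intro allI impI)
    fix e :: real assume "0 < e"
    then obtain \<Phi> where \<Phi>: "finite \<Phi>" "\<Phi> \<subseteq> A"
      "A \<subseteq> \<Phi> + (\<Inter>f\<in>{f}. {x. blinfun_apply \<bar>f\<bar> \<bar>x\<bar> < e})"
      using A unfolding abs_weakly_totally_bounded_def by (metis finite.simps)
    have "\<exists>y\<in>\<Phi>. blinfun_apply f \<bar>x - y\<bar> < e" if "x \<in> A" for x
    proof -
      obtain y z where "y \<in> \<Phi>" "x = y + z" "blinfun_apply \<bar>f\<bar> \<bar>z\<bar> < e"
        using \<Phi>(3) \<open>x \<in> A\<close> by (auto elim!: set_plus_elim dest!: subsetD)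
      then show ?thesis using f by (intro bexI[of _ y]) (simp_all add: abs_of_nonneg)
    qed
    then show "\<exists>\<Phi>. finite \<Phi> \<and> \<Phi> \<subseteq> A \<and> (\<forall>x\<in>A. \<exists>y\<in>\<Phi>. blinfun_apply f \<bar>x - y\<bar> < e)"
      using \<Phi> by blast
  qed
next
  assume A: "\<forall>f\<ge>0. seminorm_totally_bounded f A"
  show "abs_weakly_totally_bounded A" unfolding abs_weakly_totally_bounded_def
  proof (intro allI impI)
    fix e :: real and G :: "'a dual set" assume e: "0 < e" and G: "finite G"
    define f where "f = (\<Sum>g\<in>G. \<bar>g\<bar>)"
    have "0 \<le> f" unfolding f_def by (intro sum_nonneg abs_ge_zero)
    then have "seminorm_totally_bounded f A" using A by blast
    then obtain \<Phi> where \<Phi>: "finite \<Phi>" "\<Phi> \<subseteq> A" "\<forall>x\<in>A. \<exists>y\<in>\<Phi>. blinfun_apply f \<bar>x - y\<bar> < e"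
      using e unfolding seminorm_totally_bounded_def by meson
    have "A \<subseteq> \<Phi> + (\<Inter>f\<in>G. {x. blinfun_apply \<bar>f\<bar> \<bar>x\<bar> < e})"
    proof
      fix x assume "x \<in> A"
      then obtain y where y: "y \<in> \<Phi>" "blinfun_apply f \<bar>x - y\<bar> < e" using \<Phi> by blast
      have "blinfun_apply \<bar>g\<bar> \<bar>x - y\<bar> \<le> blinfun_apply f \<bar>x - y\<bar>" if "g \<in> G" for g
        unfolding f_def using G that sum_mono2[of G "{g}" abs] by (intro blinfun_mono_left) auto
      then have "x - y \<in> (\<Inter>f\<in>G. {x. blinfun_apply \<bar>f\<bar> \<bar>x\<bar> < e})" using y(2) by (auto intro: le_less_trans)
      from set_plus_intro[OF y(1) this]
      show "x \<in> \<Phi> + (\<Inter>f\<in>G. {x. blinfun_apply \<bar>f\<bar> \<bar>x\<bar> < e})" by simp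
    qed
    then show "\<exists>\<Phi>. finite \<Phi> \<and> \<Phi> \<subseteq> A \<and> A \<subseteq> \<Phi> + (\<Inter>f\<in>G. {x. blinfun_apply \<bar>f\<bar> \<bar>x\<bar> < e})"
      using \<Phi> by blast
  qed
qed

text \<open>Total boundedness in terms of colourings with finitely many colours and small colour classes:
  such colourings can be pulled back along maps and combined into tuples.\<close>

lemma seminorm_totally_boundedI:
  assumes "\<And>e. 0 < e \<Longrightarrow>
    \<exists>c :: 'a::banach_lattice \<Rightarrow> 'c. finite (c ` A) \<and>
      (\<forall>x\<in>A. \<forall>y\<in>A. c x = c y \<longrightarrow> blinfun_apply f \<bar>x - y\<bar> < e)"
  shows "seminorm_totally_bounded f A"
  unfolding seminorm_totally_bounded_def
proof (intro allI impI)
  fix e :: real assume "0 < e"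
  then obtain c :: "'a \<Rightarrow> 'c" where c: "finite (c ` A)"
    "\<And>x y. x \<in> A \<Longrightarrow> y \<in> A \<Longrightarrow> c x = c y \<Longrightarrow> blinfun_apply f \<bar>x - y\<bar> < e"
    using assms by meson
  obtain \<Phi> where "\<Phi> \<subseteq> A" "finite \<Phi>" "c ` A = c ` \<Phi>"
    using finite_subset_image[OF c(1) subset_refl] by blast
  moreover have "\<exists>y\<in>\<Phi>. blinfun_apply f \<bar>x - y\<bar> < e" if x: "x \<in> A" for x
  proof -
    have "c x \<in> c ` \<Phi>" using x calculation(3) by blast
    then obtain y where "y \<in> \<Phi>" "c x = c y" by blast
    then show ?thesis using c(2)[OF x, of y] calculation(1) by blast
  qed
  ultimately show "\<exists>\<Phi>. finite \<Phi> \<and> \<Phi> \<subseteq> A \<and> (\<forall>x\<in>A. \<exists>y\<in>\<Phi>. blinfun_apply f \<bar>x - y\<bar> < e)"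
    by blast
qed

text \<open>Colour each point by a nearby centre of an \<open>e / 2\<close>-net; points sharing a
  centre are within \<open>e\<close>. Positivity of \<open>f\<close> supplies the triangle
  inequality.\<close>

lemma seminorm_totally_bounded_colouring:
  fixes A :: "'a::banach_lattice set"
  assumes A: "seminorm_totally_bounded f A" and f: "0 \<le> f" and e: "0 < e"
  obtains c :: "'a \<Rightarrow> 'a" where "finite (c ` A)"
    "\<And>x y. x \<in> A \<Longrightarrow> y \<in> A \<Longrightarrow> c x = c y \<Longrightarrow> blinfun_apply f \<bar>x - y\<bar> < e"
proof -
  obtain \<Phi> where \<Phi>: "finite \<Phi>" "\<forall>x\<in>A. \<exists>y\<in>\<Phi>. blinfun_apply f \<bar>x - y\<bar> < e / 2"
    using A e unfolding seminorm_totally_bounded_def by (meson half_gt_zero)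
  then obtain c where c: "\<And>x. x \<in> A \<Longrightarrow> c x \<in> \<Phi> \<and> blinfun_apply f \<bar>x - c x\<bar> < e / 2" by metis
  show thesis
  proof
    show "finite (c ` A)" using c \<Phi>(1) by (meson finite_subset image_subsetI)
    show "blinfun_apply f \<bar>x - y\<bar> < e" if "x \<in> A" "y \<in> A" "c x = c y" for x y
      using functional_abs_diff_triangle[OF f, of x y "c x"] c[of x] c[of y] that by simp
  qed
qed

text \<open>Net points have to lie in the set itself, so a net for \<open>A\<close> cannot simply be
  restricted to \<open>B\<close>, but a colouring can.\<close>

lemma seminorm_totally_bounded_subset:
  fixes A :: "'a::banach_lattice set"
  assumes "seminorm_totally_bounded f A" "0 \<le> f" "B \<subseteq> A"
  shows "seminorm_totally_bounded f B"
proof (rule seminorm_totally_boundedI)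
  fix e :: real assume "0 < e"
  then obtain c :: "'a \<Rightarrow> 'a" where "finite (c ` A)"
    "\<And>x y. x \<in> A \<Longrightarrow> y \<in> A \<Longrightarrow> c x = c y \<Longrightarrow> blinfun_apply f \<bar>x - y\<bar> < e"
    using seminorm_totally_bounded_colouring[OF assms(1,2)] by blast
  then show "\<exists>c :: 'a \<Rightarrow> 'a. finite (c ` B) \<and>
      (\<forall>x\<in>B. \<forall>y\<in>B. c x = c y \<longrightarrow> blinfun_apply f \<bar>x - y\<bar> < e)"
    using assms(3) by (meson finite_subset image_mono subsetD)
qed

text \<open>The seminorm is at most \<open>norm f\<close> times the norm, so norm balls of radius
  \<open>e / (norm f + 1)\<close> are small enough; the summand 1 covers
  \<open>f = 0\<close>.\<close>

lemma compact_imp_seminorm_totally_bounded: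
  fixes A :: "'a::banach_lattice set"
  assumes "compact A" and f: "0 \<le> f"
  shows "seminorm_totally_bounded f A"
  unfolding seminorm_totally_bounded_def
proof (intro allI impI)
  fix e :: real assume e: "0 < e"
  define r where "r = e / (norm f + 1)"
  have r: "0 < r" using e by (simp add: r_def add_nonneg_pos)
  obtain \<Phi> where \<Phi>: "finite \<Phi>" "\<Phi> \<subseteq> A" "A \<subseteq> (\<Union>x\<in>\<Phi>. ball x r)"
    using compactE_image[OF assms(1), of A "\<lambda>x. ball x r"] r by force
  have "\<exists>y\<in>\<Phi>. blinfun_apply f \<bar>x - y\<bar> < e" if "x \<in> A" for x
  proof -
    obtain y where y: "y \<in> \<Phi>" "norm (x - y) < r"
      using subsetD[OF \<Phi>(3) \<open>x \<in> A\<close>] by (auto simp: dist_norm norm_minus_commute)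
    have "blinfun_apply f \<bar>x - y\<bar> \<le> norm f * norm (x - y)"
      using functional_le_norm[of f "\<bar>x - y\<bar>"] by simp
    also have "\<dots> \<le> norm f * r" using y by (simp add: mult_left_mono)
    also have "\<dots> < (norm f + 1) * r" using r by (simp add: algebra_simps)
    also have "\<dots> = e" by (simp add: r_def add_nonneg_eq_0_iff)
    finally show ?thesis using y by blast
  qed
  then show "\<exists>\<Phi>. finite \<Phi> \<and> \<Phi> \<subseteq> A \<and> (\<forall>x\<in>A. \<exists>y\<in>\<Phi>. blinfun_apply f \<bar>x - y\<bar> < e)"
    using \<Phi> by blast
qed

section \<open>Energy of a dominated operator\<close>

text \<open>Completing the square. Division by zero is harmless: \<open>t = 0\<close> forces
  \<open>s = 0\<close>, and both sides vanish.\<close>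

lemma square_div_expand:
  fixes s t h :: real
  assumes "0 \<le> s" "s \<le> t"
  shows "s\<^sup>2 / t = (s - h * t)\<^sup>2 / t + 2 * h * s - h\<^sup>2 * t"
  using assms by (cases "t = 0") (auto simp: field_simps power2_eq_square)

text \<open>For the fixed slope \<open>h = s / t\<close> the expression
  \<open>2 * h * s - h\<^sup>2 * t\<close> is additive over the pieces. Hence splitting raises the
  energy by the squared deviations from \<open>h\<close>, each divided by its \<open>t\<close>; only
  that of the first piece is kept.\<close>

lemma energy_refinement:
  fixes s t s1 s2 s3 s4 t1 t2 t3 t4 :: real
  assumes "0 \<le> s1" "s1 \<le> t1" "0 \<le> s2" "s2 \<le> t2" "0 \<le> s3" "s3 \<le> t3" "0 \<le> s4" "s4 \<le> t4"
    and s: "s = s1 + s2 + s3 + s4" and t: "t = t1 + t2 + t3 + t4"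
  shows "s\<^sup>2 / t + (s1 - s / t * t1)\<^sup>2 / t1 \<le> s1\<^sup>2 / t1 + s2\<^sup>2 / t2 + s3\<^sup>2 / t3 + s4\<^sup>2 / t4"
proof -
  define h where "h = s / t"
  have "s = h * t" unfolding h_def using assms by (cases "t = 0") auto
  then have *: "s\<^sup>2 / t = 2 * h * s - h\<^sup>2 * t"
    using square_div_expand[of s t h] assms by simp
  have "0 \<le> (s2 - h * t2)\<^sup>2 / t2" "0 \<le> (s3 - h * t3)\<^sup>2 / t3" "0 \<le> (s4 - h * t4)\<^sup>2 / t4"
    using assms by (auto intro!: divide_nonneg_nonneg)
  moreover have "2 * h * s - h\<^sup>2 * t = (2 * h * s1 - h\<^sup>2 * t1) + (2 * h * s2 - h\<^sup>2 * t2) +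
      (2 * h * s3 - h\<^sup>2 * t3) + (2 * h * s4 - h\<^sup>2 * t4)"
    unfolding s t by (simp add: algebra_simps)
  ultimately show ?thesis
    unfolding * h_def[symmetric]
    using square_div_expand[of s1 t1 h] square_div_expand[of s2 t2 h]
      square_div_expand[of s3 t3 h] square_div_expand[of s4 t4 h] assms(1-8)
    by linarith
qed

lemma sum_lessThan_add: "sum F {..<n + m} = sum F {..<n} + (\<Sum>i<m. F (n + i))"
  for F :: "nat \<Rightarrow> 'a::comm_monoid_add"
  by (induction m) (simp_all add: add.assoc)

text \<open>Indices below \<open>n\<close> carry the parts \<open>x i\<close>, the next
  \<open>n\<close> their complements \<open>u i - x i\<close>: the bookkeeping for splitting every
  piece of a partition in two.\<close>

lemma sum_halved:
  fixes u x :: "nat \<Rightarrow> 'a::ab_group_add" and F :: "'a \<Rightarrow> 'b::comm_monoid_add"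
  shows "(\<Sum>i<n + n. F (if i < n then x i else u (i - n) - x (i - n))) = (\<Sum>i<n. F (x i) + F (u i - x i))"
  by (simp add: sum_lessThan_add sum.distrib)

text \<open>Weighted inequality of arithmetic and geometric means: expand
  \<open>(\<bar>d\<bar> - c * t)\<^sup>2 \<ge> 0\<close> and divide by
  \<open>2 * c * t\<close>.\<close>

lemma le_square_div_add:
  fixes d t c :: real
  assumes "0 < c" "0 \<le> t" "t = 0 \<Longrightarrow> d = 0"
  shows "\<bar>d\<bar> \<le> d\<^sup>2 / t / (2 * c) + c * t / 2"
proof (cases "t = 0")
  case False
  then have t: "0 < t" using assms by simp
  have "0 \<le> (\<bar>d\<bar> - c * t)\<^sup>2 / (2 * c * t)" using assms t by simp
  also have "\<dots> = d\<^sup>2 / t / (2 * c) + c * t / 2 - \<bar>d\<bar>"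
    using assms t by (simp add: field_simps power2_eq_square)
  finally show ?thesis by simp
qed (use assms in simp)

text \<open>A partition maximising the energy \<open>\<Sum> \<sigma>\<^sup>2 / \<tau>\<close> up to a small error: on every refinement
  \<open>\<sigma>\<close> is close to the multiple of \<open>\<tau>\<close> prescribed by the partition, since the deviation is
  bounded by the energy gain.\<close>

lemma energy_maximal_partition:
  fixes S T :: "'e::banach_lattice \<Rightarrow>\<^sub>L 'f::banach_lattice" and f :: "'f dual"
  assumes S: "0 \<le> S" "S \<le> T" and U: "0 \<le> U" and f: "0 \<le> f" and e: "0 < e"
  obtains n m :: nat and u :: "nat \<Rightarrow> 'e" and g :: "nat \<Rightarrow> 'f dual" and h :: "nat \<Rightarrow> nat \<Rightarrow> real"
  where "\<And>i. i < n \<Longrightarrow> 0 \<le> u i" "(\<Sum>i<n. u i) = U"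
    "\<And>j. j < m \<Longrightarrow> 0 \<le> g j" "(\<Sum>j<m. g j) = f"
    "\<And>i j. i < n \<Longrightarrow> j < m \<Longrightarrow> 0 \<le> h i j \<and> h i j \<le> 1"
    "\<And>x y. (\<And>i. i < n \<Longrightarrow> 0 \<le> x i \<and> x i \<le> u i) \<Longrightarrow> (\<And>j. j < m \<Longrightarrow> 0 \<le> y j \<and> y j \<le> g j) \<Longrightarrow>
      (\<Sum>i<n. \<Sum>j<m. \<bar>blinfun_apply (y j) (blinfun_apply S (x i)) -
        h i j * blinfun_apply (y j) (blinfun_apply T (x i))\<bar>) \<le> e"
proof -
  define \<sigma> where "\<sigma> x g = blinfun_apply g (blinfun_apply S x)" for x and g :: "'f dual"
  define \<tau> where "\<tau> x g = blinfun_apply g (blinfun_apply T x)" for x and g :: "'f dual"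
  have \<sigma>0: "0 \<le> \<sigma> x g" if "0 \<le> x" "0 \<le> g" for x g
    unfolding \<sigma>_def by (intro blinfun_nonneg that S)
  have \<sigma>\<tau>: "\<sigma> x g \<le> \<tau> x g" if "0 \<le> x" "0 \<le> g" for x g
    unfolding \<sigma>_def \<tau>_def by (intro blinfun_mono blinfun_mono_left that S)
  have \<tau>0: "0 \<le> \<tau> x g" if "0 \<le> x" "0 \<le> g" for x g
    using \<sigma>0 \<sigma>\<tau> that by (meson order_trans)
  define q where "q x g = (\<sigma> x g)\<^sup>2 / \<tau> x g" for x g
  define part where "part n u m g \<longleftrightarrow> (\<forall>i<n. 0 \<le> u i) \<and> (\<Sum>i<n. u i) = U \<and>
    (\<forall>j<m. 0 \<le> g j) \<and> (\<Sum>j<m. g j) = f" for n m :: nat and u g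
  define en where "en n u m g = (\<Sum>i<n. \<Sum>j<m. q (u i) (g j))" for n m :: nat and u g
  define E where "E = {en n u m g |n u m g. part n u m g}"
  have sum\<tau>: "(\<Sum>i<n. \<Sum>j<m. \<tau> (u i) (g j)) = \<tau> U f" if "part n u m g" for n m u g
  proof -
    have "(\<Sum>j<m. \<tau> x (g j)) = \<tau> x f" for x
      using that by (simp add: \<tau>_def part_def flip: blinfun.sum_left)
    moreover have "(\<Sum>i<n. \<tau> (u i) f) = \<tau> U f"
      using that by (simp add: \<tau>_def part_def flip: blinfun.sum_right)
    ultimately show ?thesis by simp
  qed
  have q: "q x g \<le> \<tau> x g" if "0 \<le> x" "0 \<le> g" for x g
  proof (cases "\<tau> x g = 0")
    case False
    have "\<sigma> x g * \<sigma> x g \<le> \<tau> x g * \<tau> x g"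
      using \<sigma>0 \<sigma>\<tau> \<tau>0 that by (intro mult_mono) auto
    then show ?thesis
      using False \<tau>0[OF that] by (simp add: q_def field_simps power2_eq_square)
  qed (simp add: q_def)
  have en_le: "en n u m g \<le> \<tau> U f" if "part n u m g" for n m u g
    using that unfolding sum\<tau>[OF that, symmetric] en_def part_def
    by (intro sum_mono q) auto
  have bdd: "bdd_above E" unfolding E_def by (rule bdd_aboveI[where M = "\<tau> U f"]) (auto intro: en_le)
  \<comment> \<open>This weight balances the final estimate: an energy gain of at most
    \<open>e * c\<close> and a total mass of at most \<open>\<tau> U f\<close> contribute at most
    \<open>e / 2\<close> each.\<close>
  define c where "c = e / (\<tau> U f + 1)"
  have c: "0 < c" using e \<tau>0[OF U f] by (simp add: c_def)
  have part1: "part 1 (\<lambda>_. U) 1 (\<lambda>_. f)" using U f by (simp add: part_def)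
  then have "E \<noteq> {}" unfolding E_def by blast
  then have "\<exists>z\<in>E. Sup E - e * c < z"
    using c e by (intro less_cSupD) auto
  then obtain n u m g where p: "part n u m g" and near: "Sup E - e * c < en n u m g"
    unfolding E_def by blast
  \<comment> \<open>The slope of \<open>S\<close> against \<open>T\<close> on a pair of pieces; it
    is 0 where \<open>\<tau>\<close> vanishes, as division by 0 gives 0.\<close>
  define h where "h i j = \<sigma> (u i) (g j) / \<tau> (u i) (g j)" for i j
  show thesis
  proof
    show "(\<Sum>i<n. u i) = U" "(\<Sum>j<m. g j) = f" using p by (simp_all add: part_def)
    show "0 \<le> u i" if "i < n" for i using p that by (simp add: part_def)
    show "0 \<le> g j" if "j < m" for j using p that by (simp add: part_def)
    show "0 \<le> h i j \<and> h i j \<le> 1" if "i < n" "j < m" for i j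
      using p that \<sigma>0[of "u i" "g j"] \<tau>0[of "u i" "g j"] \<sigma>\<tau>[of "u i" "g j"]
      by (auto simp: h_def part_def divide_le_eq_1)
  next
    fix x y
    assume x: "\<And>i. i < n \<Longrightarrow> 0 \<le> x i \<and> x i \<le> u i" and y: "\<And>j. j < m \<Longrightarrow> 0 \<le> y j \<and> y j \<le> g j"
    \<comment> \<open>Each piece is split into the given part and its complement, so every pair of
      old pieces becomes four new pairs.\<close>
    define u' where "u' i = (if i < n then x i else u (i - n) - x (i - n))" for i
    define g' where "g' j = (if j < m then y j else g (j - m) - y (j - m))" for j
    define d where "d i j = \<sigma> (x i) (y j) - h i j * \<tau> (x i) (y j)" for i j
    have u'sum: "(\<Sum>i<n + n. F (u' i)) = (\<Sum>i<n. F (x i) + F (u i - x i))" for F :: "'e \<Rightarrow> 'c::comm_monoid_add"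
      unfolding u'_def by (rule sum_halved)
    have g'sum: "(\<Sum>j<m + m. F (g' j)) = (\<Sum>j<m. F (y j) + F (g j - y j))" for F :: "'f dual \<Rightarrow> 'c::comm_monoid_add"
      unfolding g'_def by (rule sum_halved)
    have "part (n + n) u' (m + m) g'"
      using p x y u'sum[of "\<lambda>x. x"] g'sum[of "\<lambda>x. x"] by (auto simp: part_def u'_def g'_def)
    then have "en (n + n) u' (m + m) g' \<le> Sup E"
      using bdd by (intro cSup_upper) (auto simp: E_def)
    then have "en (n + n) u' (m + m) g' - en n u m g \<le> e * c" using near by simp
    moreover have "en (n + n) u' (m + m) g' =
      (\<Sum>i<n. \<Sum>j<m. q (x i) (y j) + q (x i) (g j - y j) +
        q (u i - x i) (y j) + q (u i - x i) (g j - y j))"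
    proof -
      have "(\<Sum>j<m + m. q z (g' j)) = (\<Sum>j<m. q z (y j) + q z (g j - y j))" for z
        by (rule g'sum)
      then have "en (n + n) u' (m + m) g' = (\<Sum>i<n + n. \<Sum>j<m. q (u' i) (y j) + q (u' i) (g j - y j))"
        by (simp add: en_def)
      also have "\<dots> = (\<Sum>i<n. (\<Sum>j<m. q (x i) (y j) + q (x i) (g j - y j)) +
          (\<Sum>j<m. q (u i - x i) (y j) + q (u i - x i) (g j - y j)))"
        by (rule u'sum)
      finally show ?thesis by (simp add: sum.distrib add.assoc)
    qed
    moreover have "q (u i) (g j) + (d i j)\<^sup>2 / \<tau> (x i) (y j) \<le> q (x i) (y j) + q (x i) (g j - y j) +
        q (u i - x i) (y j) + q (u i - x i) (g j - y j)" if "i < n" "j < m" for i j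
      unfolding q_def d_def h_def
    proof (rule energy_refinement)
      have 0: "0 \<le> x i" "0 \<le> u i - x i" "0 \<le> y j" "0 \<le> g j - y j" using x y that by auto
      show "0 \<le> \<sigma> (x i) (y j)" "0 \<le> \<sigma> (x i) (g j - y j)" "0 \<le> \<sigma> (u i - x i) (y j)"
        "0 \<le> \<sigma> (u i - x i) (g j - y j)" "\<sigma> (x i) (y j) \<le> \<tau> (x i) (y j)"
        "\<sigma> (x i) (g j - y j) \<le> \<tau> (x i) (g j - y j)" "\<sigma> (u i - x i) (y j) \<le> \<tau> (u i - x i) (y j)"
        "\<sigma> (u i - x i) (g j - y j) \<le> \<tau> (u i - x i) (g j - y j)"
        using 0 \<sigma>0 \<sigma>\<tau> by auto
    qed (simp_all add: \<sigma>_def \<tau>_def blinfun.diff_left blinfun.diff_right)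
    then have "en n u m g + (\<Sum>i<n. \<Sum>j<m. (d i j)\<^sup>2 / \<tau> (x i) (y j)) \<le>
      (\<Sum>i<n. \<Sum>j<m. q (x i) (y j) + q (x i) (g j - y j) +
        q (u i - x i) (y j) + q (u i - x i) (g j - y j))"
      unfolding en_def sum.distrib[symmetric] by (intro sum_mono) auto
    \<comment> \<open>The refined partition still competes for \<open>Sup E\<close>, so its gain
      over the nearly optimal one bounds all deviations together.\<close>
    ultimately have gain: "(\<Sum>i<n. \<Sum>j<m. (d i j)\<^sup>2 / \<tau> (x i) (y j)) \<le> e * c" by linarith
    have "\<tau> (x i) (y j) \<le> \<tau> (u i) (g j)" if "i < n" "j < m" for i j
    proof -
      have T: "0 \<le> T" using S by (rule order_trans)
      have "\<tau> (x i) (y j) \<le> \<tau> (x i) (g j)"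
        unfolding \<tau>_def using that x y T by (intro blinfun_mono_left blinfun_nonneg) auto
      also have "\<dots> \<le> \<tau> (u i) (g j)"
        unfolding \<tau>_def using that x p T by (intro blinfun_mono) (auto simp: part_def)
      finally show ?thesis .
    qed
    then have total: "(\<Sum>i<n. \<Sum>j<m. \<tau> (x i) (y j)) \<le> \<tau> U f"
      unfolding sum\<tau>[OF p, symmetric] by (intro sum_mono) auto
    have "(\<Sum>i<n. \<Sum>j<m. \<bar>d i j\<bar>) \<le>
      (\<Sum>i<n. \<Sum>j<m. (d i j)\<^sup>2 / \<tau> (x i) (y j) / (2 * c) + c * \<tau> (x i) (y j) / 2)"
    proof (intro sum_mono le_square_div_add c)
      fix i j assume "i \<in> {..<n}" "j \<in> {..<m}"
      then have 0: "0 \<le> x i" "0 \<le> y j" using x y by auto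
      then show "0 \<le> \<tau> (x i) (y j)" by (rule \<tau>0)
      show "d i j = 0" if "\<tau> (x i) (y j) = 0"
        using \<sigma>0[OF 0] \<sigma>\<tau>[OF 0] that by (simp add: d_def)
    qed
    also have "\<dots> = (\<Sum>i<n. \<Sum>j<m. (d i j)\<^sup>2 / \<tau> (x i) (y j)) / (2 * c) +
        c * (\<Sum>i<n. \<Sum>j<m. \<tau> (x i) (y j)) / 2"
      by (simp add: sum.distrib sum_divide_distrib sum_distrib_left)
    also have "\<dots> \<le> e * c / (2 * c) + c * \<tau> U f / 2"
      using gain total c by (intro add_mono divide_right_mono mult_left_mono) auto
    also have "\<dots> \<le> e / 2 + c * (\<tau> U f + 1) / 2" using c by simp
    also have "\<dots> = e" using \<tau>0[OF U f] by (simp add: c_def)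
    finally show "(\<Sum>i<n. \<Sum>j<m. \<bar>blinfun_apply (y j) (blinfun_apply S (x i)) -
        h i j * blinfun_apply (y j) (blinfun_apply T (x i))\<bar>) \<le> e"
      by (simp add: d_def \<sigma>_def \<tau>_def)
  qed
qed

section \<open>Images of order intervals under dominated operators\<close>

text \<open>A colouring of the domain that does not factor through \<open>S\<close> can still be
  used: each image point gets the colour of one chosen preimage.\<close>

lemma seminorm_totally_bounded_imageI:
  fixes S :: "'b \<Rightarrow> 'a::banach_lattice"
  assumes "\<And>e. 0 < e \<Longrightarrow> \<exists>c :: 'b \<Rightarrow> 'c. finite (c ` A) \<and>
      (\<forall>x\<in>A. \<forall>y\<in>A. c x = c y \<longrightarrow> blinfun_apply f \<bar>S x - S y\<bar> < e)"
  shows "seminorm_totally_bounded f (S ` A)"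
proof (rule seminorm_totally_boundedI)
  fix e :: real assume "0 < e"
  then obtain c :: "'b \<Rightarrow> 'c" where c: "finite (c ` A)"
    "\<And>x y. x \<in> A \<Longrightarrow> y \<in> A \<Longrightarrow> c x = c y \<Longrightarrow> blinfun_apply f \<bar>S x - S y\<bar> < e"
    using assms by meson
  let ?i = "inv_into A S"
  have "(c \<circ> ?i) ` S ` A \<subseteq> c ` A" by (auto simp: inv_into_into)
  then have "finite ((c \<circ> ?i) ` S ` A)" using c(1) by (rule finite_subset)
  moreover have "blinfun_apply f \<bar>x - y\<bar> < e"
    if "x \<in> S ` A" "y \<in> S ` A" "(c \<circ> ?i) x = (c \<circ> ?i) y" for x y
    using c(2)[OF inv_into_into[OF that(1)] inv_into_into[OF that(2)]] that
    by (simp add: f_inv_into_f)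
  ultimately show "\<exists>c :: 'a \<Rightarrow> 'c. finite (c ` S ` A) \<and>
      (\<forall>x\<in>S ` A. \<forall>y\<in>S ` A. c x = c y \<longrightarrow> blinfun_apply f \<bar>x - y\<bar> < e)" by blast
qed

text \<open>Induction on \<open>n\<close>: the infimum of \<open>x\<close> with the sum of the first
  \<open>n\<close> summands is split further, and the remainder lies below the last summand.\<close>

lemma riesz_decomposition_sum:
  fixes u :: "nat \<Rightarrow> 'a::banach_lattice"
  assumes "0 \<le> x" "x \<le> (\<Sum>i<n. u i)" "\<And>i. i < n \<Longrightarrow> 0 \<le> u i"
  shows "\<exists>z. (\<forall>i<n. 0 \<le> z i \<and> z i \<le> u i) \<and> (\<Sum>i<n. z i) = x"
  using assms
proof (induction n arbitrary: x)
  case (Suc n)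
  define a where "a = inf x (\<Sum>i<n. u i)"
  have s: "0 \<le> (\<Sum>i<n. u i)" using Suc.prems by (intro sum_nonneg) auto
  have r: "0 \<le> a" "a \<le> (\<Sum>i<n. u i)" "0 \<le> x - a" "x - a \<le> u n"
    using riesz_decomposition[of x "\<Sum>i<n. u i" "u n"] Suc.prems s by (simp_all add: a_def)
  obtain z where z: "\<And>i. i < n \<Longrightarrow> 0 \<le> z i \<and> z i \<le> u i" "(\<Sum>i<n. z i) = a"
    using Suc.IH[OF r(1,2)] Suc.prems by (metis less_SucI)
  show ?case
  proof (intro exI[of _ "z(n := x - a)"] conjI allI impI)
    have "(\<Sum>i<n. (z(n := x - a)) i) = (\<Sum>i<n. z i)" by (intro sum.cong) auto
    then show "(\<Sum>i<Suc n. (z(n := x - a)) i) = x" using z by simp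
  qed (use z r in \<open>auto simp: less_Suc_eq\<close>)
qed simp

text \<open>Write \<open>x\<close> as a sum of pieces below the \<open>u i\<close> and colour it by
  the colours of \<open>T\<close> on these pieces. A positive functional \<open>k \<le> f\<close>
  splits along the \<open>g j\<close>, so \<open>k (S x)\<close> is close to a combination of values
  of \<open>T\<close>, which equal colours nearly fix. The estimate is uniform in \<open>k\<close>,
  which allows passing to the modulus of \<open>S x - S y\<close>.\<close>

lemma dominated_interval_image_totally_bounded:
  fixes S T :: "'e::banach_lattice \<Rightarrow>\<^sub>L 'f::banach_lattice" and f :: "'f dual"
  assumes S: "0 \<le> S" "S \<le> T" and f: "0 \<le> f" and U: "0 \<le> U"
    and T: "seminorm_totally_bounded f (blinfun_apply T ` {0..U})"
  shows "seminorm_totally_bounded f (blinfun_apply S ` {0..U})"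
proof (rule seminorm_totally_bounded_imageI)
  fix e :: real assume e: "0 < e"
  then have e8: "0 < e / 8" by simp
  obtain n m :: nat and u :: "nat \<Rightarrow> 'e" and g :: "nat \<Rightarrow> 'f dual" and h :: "nat \<Rightarrow> nat \<Rightarrow> real"
    where u: "\<And>i. i < n \<Longrightarrow> 0 \<le> u i" "(\<Sum>i<n. u i) = U"
    and g: "\<And>j. j < m \<Longrightarrow> 0 \<le> g j" "(\<Sum>j<m. g j) = f"
    and h: "\<And>i j. i < n \<Longrightarrow> j < m \<Longrightarrow> 0 \<le> h i j \<and> h i j \<le> 1"
    and near: "\<And>x y. (\<And>i. i < n \<Longrightarrow> 0 \<le> x i \<and> x i \<le> u i) \<Longrightarrow>
      (\<And>j. j < m \<Longrightarrow> 0 \<le> y j \<and> y j \<le> g j) \<Longrightarrow>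
      (\<Sum>i<n. \<Sum>j<m. \<bar>blinfun_apply (y j) (blinfun_apply S (x i)) -
        h i j * blinfun_apply (y j) (blinfun_apply T (x i))\<bar>) \<le> e / 8"
    by (rule energy_maximal_partition[OF S U f e8]) blast
  \<comment> \<open>All \<open>n * m\<close> errors together stay below \<open>e / 4\<close>; the
    summand 1 covers \<open>n * m = 0\<close> and makes the bound strict.\<close>
  define \<eta> where "\<eta> = e / (4 * (real n * real m + 1))"
  have "0 < real n * real m + 1" by (intro add_nonneg_pos mult_nonneg_nonneg) auto
  then have \<eta>: "0 < \<eta>" "n * m * \<eta> < e / 4" using e by (simp_all add: \<eta>_def field_simps)
  obtain c :: "'f \<Rightarrow> 'f" where c: "finite (c ` blinfun_apply T ` {0..U})"
    "\<And>x y. x \<in> blinfun_apply T ` {0..U} \<Longrightarrow> y \<in> blinfun_apply T ` {0..U} \<Longrightarrow> c x = c y \<Longrightarrow>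
      blinfun_apply f \<bar>x - y\<bar> < \<eta>"
    by (rule seminorm_totally_bounded_colouring[OF T f \<eta>(1)]) blast
  have "\<exists>z. (\<forall>i<n. 0 \<le> z i \<and> z i \<le> u i) \<and> (\<Sum>i<n. z i) = x" if "x \<in> {0..U}" for x
    using that u by (intro riesz_decomposition_sum) auto
  then obtain Z where Z: "\<And>x i. x \<in> {0..U} \<Longrightarrow> i < n \<Longrightarrow> 0 \<le> Z x i \<and> Z x i \<le> u i"
    "\<And>x. x \<in> {0..U} \<Longrightarrow> (\<Sum>i<n. Z x i) = x" by metis
  have uU: "u i \<le> U" if "i < n" for i
    unfolding u(2)[symmetric] using sum_mono2[of "{..<n}" "{i}" u] u(1) that by auto
  have ZU: "Z x i \<in> {0..U}" if "x \<in> {0..U}" "i < n" for x i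
    using Z(1)[OF that] uU[OF that(2)] by auto
  define C where "C x = map (\<lambda>i. c (blinfun_apply T (Z x i))) [0..<n]" for x
  have "C ` {0..U} \<subseteq> {xs. set xs \<subseteq> c ` blinfun_apply T ` {0..U} \<and> length xs = n}"
    using ZU by (auto simp: C_def)
  then have finite: "finite (C ` {0..U})"
    using finite_lists_length_eq[OF c(1)] by (rule finite_subset)
  \<comment> \<open>Replacing \<open>S\<close> by the combination \<open>H\<close> costs
    \<open>e / 8\<close> at \<open>x\<close> and again at \<open>y\<close>, and \<open>H\<close>
    itself varies by less than \<open>e / 4\<close>.\<close>
  have main: "blinfun_apply k (blinfun_apply S x - blinfun_apply S y) < e / 2"
    if x: "x \<in> {0..U}" and y: "y \<in> {0..U}" and C: "C x = C y" and k: "0 \<le> k" "k \<le> f"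
    for x y and k :: "'f dual"
  proof -
    obtain w where w: "\<And>j. j < m \<Longrightarrow> 0 \<le> w j \<and> w j \<le> g j" "(\<Sum>j<m. w j) = k"
      using riesz_decomposition_sum[of k g m] k g by auto
    have wf: "w j \<le> f" if "j < m" for j
      using sum_mono2[of "{..<m}" "{j}" w] w that k by auto
    define H where "H v = (\<Sum>i<n. \<Sum>j<m. h i j * blinfun_apply (w j) (blinfun_apply T (Z v i)))" for v
    have kS: "blinfun_apply k (blinfun_apply S v) =
      (\<Sum>i<n. \<Sum>j<m. blinfun_apply (w j) (blinfun_apply S (Z v i)))" if "v \<in> {0..U}" for v
      by (subst Z(2)[OF that, symmetric])
        (simp add: blinfun.sum_left blinfun.sum_right w(2)[symmetric] sum.swap[of _ "{..<m}"])
    have approx: "\<bar>blinfun_apply k (blinfun_apply S v) - H v\<bar> \<le> e / 8" if v: "v \<in> {0..U}" for v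
    proof -
      have "\<bar>blinfun_apply k (blinfun_apply S v) - H v\<bar> \<le>
        (\<Sum>i<n. \<Sum>j<m. \<bar>blinfun_apply (w j) (blinfun_apply S (Z v i)) -
          h i j * blinfun_apply (w j) (blinfun_apply T (Z v i))\<bar>)"
        unfolding kS[OF v] H_def sum_subtractf[symmetric]
        by (intro order_trans[OF sum_abs] sum_mono) auto
      also have "\<dots> \<le> e / 8" using Z(1)[OF v] w(1) by (intro near) auto
      finally show ?thesis .
    qed
    have "\<bar>H x - H y\<bar> \<le> (\<Sum>i<n. \<Sum>j<m. \<eta>)"
      unfolding H_def sum_subtractf[symmetric]
    proof (intro order_trans[OF sum_abs] sum_mono)
      fix i j assume "i \<in> {..<n}" "j \<in> {..<m}"
      then have i: "i < n" and j: "j < m" by auto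
      let ?v = "blinfun_apply T (Z x i) - blinfun_apply T (Z y i)"
      have "c (blinfun_apply T (Z x i)) = c (blinfun_apply T (Z y i))"
        using C i by (auto simp: C_def)
      then have "blinfun_apply f \<bar>?v\<bar> < \<eta>" by (intro c(2) imageI ZU x y i)
      have "\<bar>h i j * blinfun_apply (w j) (blinfun_apply T (Z x i)) -
        h i j * blinfun_apply (w j) (blinfun_apply T (Z y i))\<bar> = h i j * \<bar>blinfun_apply (w j) ?v\<bar>"
        using h[OF i j] by (simp add: blinfun.diff_right abs_mult flip: right_diff_distrib)
      also have "\<dots> \<le> 1 * blinfun_apply f \<bar>?v\<bar>"
      proof (rule mult_mono)
        have "\<bar>blinfun_apply (w j) ?v\<bar> \<le> blinfun_apply (w j) \<bar>?v\<bar>"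
          using w(1)[OF j] by (intro abs_blinfun_apply_le) simp
        also have "\<dots> \<le> blinfun_apply f \<bar>?v\<bar>" by (rule blinfun_mono_left[OF wf[OF j]]) simp
        finally show "\<bar>blinfun_apply (w j) ?v\<bar> \<le> blinfun_apply f \<bar>?v\<bar>" .
      qed (use h[OF i j] in auto)
      finally show "\<bar>h i j * blinfun_apply (w j) (blinfun_apply T (Z x i)) -
        h i j * blinfun_apply (w j) (blinfun_apply T (Z y i))\<bar> \<le> \<eta>"
        using \<open>blinfun_apply f \<bar>?v\<bar> < \<eta>\<close> by simp
    qed
    also have "\<dots> < e / 4" using \<eta> by (simp add: mult.assoc)
    finally show ?thesis
      unfolding blinfun.diff_right using approx[OF x] approx[OF y] by linarith
  qed
  have "blinfun_apply f \<bar>blinfun_apply S x - blinfun_apply S y\<bar> < e"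
    if x: "x \<in> {0..U}" and y: "y \<in> {0..U}" and C: "C x = C y" for x y
  proof -
    let ?v = "blinfun_apply S x - blinfun_apply S y"
    \<comment> \<open>The value of \<open>f\<close> at \<open>pprt ?v\<close> is the value at
      \<open>?v\<close> of some \<open>k\<close> in \<open>{0..f}\<close>, so \<open>main\<close>
      applies; exchanging \<open>x\<close> and \<open>y\<close> treats the negative part.\<close>
    have "blinfun_apply f (pprt ?v) < e / 2"
      using functional_pprt_attained[OF f, of ?v] main[OF x y C] by metis
    moreover have "blinfun_apply f (pprt (- ?v)) < e / 2"
      using functional_pprt_attained[OF f, of "- ?v"] main[OF y x C[symmetric]] by (metis minus_diff_eq)
    ultimately show ?thesis by (simp add: abs_eq_pprt blinfun.add_right)
  qed
  then show "\<exists>C :: 'e \<Rightarrow> 'f list. finite (C ` {0..U}) \<and> (\<forall>x\<in>{0..U}. \<forall>y\<in>{0..U}. C x = C y \<longrightarrow>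
      blinfun_apply f \<bar>blinfun_apply S x - blinfun_apply S y\<bar> < e)"
    using finite by (intro exI[of _ C]) blast
qed

section \<open>Domination\<close>

text \<open>Both parts of \<open>x = pprt x - pprt (- x)\<close> stay in the ball, so approximants
  of positive vectors suffice: colour \<open>x\<close> by the pair of colours of the approximants of
  its parts. The set \<open>K\<close> may depend on \<open>e\<close> and may leave the image of
  \<open>S\<close>.\<close>

lemma ball_image_totally_boundedI:
  fixes S :: "'e::banach_lattice \<Rightarrow>\<^sub>L 'f::banach_lattice" and f :: "'f dual"
  assumes f: "0 \<le> f" and approx: "\<And>e. 0 < e \<Longrightarrow> \<exists>K. seminorm_totally_bounded f K \<and>
    (\<forall>x\<ge>0. norm x \<le> 1 \<longrightarrow> (\<exists>k\<in>K. blinfun_apply f \<bar>blinfun_apply S x - k\<bar> < e))"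
  shows "seminorm_totally_bounded f (blinfun_apply S ` cball 0 1)"
proof (rule seminorm_totally_bounded_imageI)
  fix e :: real assume e: "0 < e"
  then obtain K p where K: "seminorm_totally_bounded f K"
    and p: "\<And>x. 0 \<le> x \<Longrightarrow> norm x \<le> 1 \<Longrightarrow> p x \<in> K \<and> blinfun_apply f \<bar>blinfun_apply S x - p x\<bar> < e / 8"
    using approx[of "e / 8"] by (metis divide_pos_pos zero_less_numeral)
  obtain c :: "'f \<Rightarrow> 'f" where c: "finite (c ` K)"
    "\<And>x y. x \<in> K \<Longrightarrow> y \<in> K \<Longrightarrow> c x = c y \<Longrightarrow> blinfun_apply f \<bar>x - y\<bar> < e / 4"
    using seminorm_totally_bounded_colouring[OF K f, of "e / 4"] e by auto
  define C where "C x = (c (p (pprt x)), c (p (pprt (- x))))" for x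
  have n: "norm (pprt x) \<le> 1" "norm (pprt (- x)) \<le> 1" if "x \<in> cball 0 1" for x :: 'e
    using that norm_pprt_le[of x] norm_pprt_le[of "- x"] by simp_all
  have "C ` cball 0 1 \<subseteq> c ` K \<times> c ` K"
    using p n by (auto simp: C_def)
  then have fin: "finite (C ` cball 0 1)"
    by (rule finite_subset) (simp add: c(1))
  have half: "blinfun_apply f \<bar>blinfun_apply S x - blinfun_apply S y\<bar> < e / 2"
    if "0 \<le> x" "norm x \<le> 1" "0 \<le> y" "norm y \<le> 1" "c (p x) = c (p y)" for x y
    using functional_abs_diff_triangle[OF f, of "blinfun_apply S x" "blinfun_apply S y" "p x"]
      functional_abs_diff_triangle[OF f, of "blinfun_apply S y" "p x" "p y"]
      p[of x] p[of y] c(2)[of "p x" "p y"] that by (simp add: abs_minus_commute)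
  have "blinfun_apply f \<bar>blinfun_apply S x - blinfun_apply S y\<bar> < e"
    if x: "x \<in> cball 0 1" and y: "y \<in> cball 0 1" and C: "C x = C y" for x y
  proof -
    have eq: "blinfun_apply S x - blinfun_apply S y =
      (blinfun_apply S (pprt x) - blinfun_apply S (pprt y)) +
      (blinfun_apply S (pprt (- y)) - blinfun_apply S (pprt (- x)))"
      by (subst (1 2) pprt_eq_diff[symmetric]) (simp add: blinfun.diff_right)
    have 1: "blinfun_apply f \<bar>blinfun_apply S (pprt x) - blinfun_apply S (pprt y)\<bar> < e / 2"
      using C n x y by (intro half) (auto simp: C_def)
    have 2: "blinfun_apply f \<bar>blinfun_apply S (pprt (- y)) - blinfun_apply S (pprt (- x))\<bar> < e / 2"
      using C n x y by (intro half) (auto simp: C_def)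
    show ?thesis
      unfolding eq by (rule le_less_trans[OF functional_abs_triangle[OF f]]) (use 1 2 in linarith)
  qed
  then show "\<exists>C :: 'e \<Rightarrow> 'f \<times> 'f. finite (C ` cball 0 1) \<and> (\<forall>x\<in>cball 0 1. \<forall>y\<in>cball 0 1. C x = C y \<longrightarrow>
      blinfun_apply f \<bar>blinfun_apply S x - blinfun_apply S y\<bar> < e)"
    using fin by (intro exI[of _ C]) blast
qed

text \<open>Let \<open>u\<close> be the sum of the moduli of a net for the image of
  \<open>T\<close>. Then \<open>S x \<le> T x \<le> u + \<bar>T x - y\<bar>\<close>, so the
  truncation \<open>inf (S x) u\<close> is as close to \<open>S x\<close> as \<open>T x\<close> is
  to its net point \<open>y\<close>.\<close>

lemma dominated_PL_compact_if_intervals_totally_bounded: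
  fixes S T :: "'e::banach_lattice \<Rightarrow>\<^sub>L 'f::banach_lattice"
  assumes S: "0 \<le> S" "S \<le> T" and T: "PL_compact T"
    and intervals: "\<And>a b :: 'f. abs_weakly_totally_bounded {a..b}"
  shows "PL_compact S"
  unfolding PL_compact_def abs_weakly_totally_bounded_iff
proof (intro allI impI ball_image_totally_boundedI)
  fix f :: "'f dual" and e :: real assume f: "0 \<le> f" and e: "0 < e"
  obtain \<Phi> where \<Phi>: "finite \<Phi>"
    "\<And>x. norm x \<le> 1 \<Longrightarrow> \<exists>y\<in>\<Phi>. blinfun_apply f \<bar>blinfun_apply T x - y\<bar> < e"
    using T f e unfolding PL_compact_def abs_weakly_totally_bounded_iff
      seminorm_totally_bounded_def by (metis image_eqI mem_cball_0)
  define u where "u = (\<Sum>y\<in>\<Phi>. \<bar>y\<bar>)"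
  show "\<exists>K. seminorm_totally_bounded f K \<and>
    (\<forall>x\<ge>0. norm x \<le> 1 \<longrightarrow> (\<exists>k\<in>K. blinfun_apply f \<bar>blinfun_apply S x - k\<bar> < e))"
  proof (intro exI[of _ "{0..u}"] conjI allI impI)
    show "seminorm_totally_bounded f {0..u}"
      using intervals f by (simp add: abs_weakly_totally_bounded_iff)
    fix x :: 'e assume x: "0 \<le> x" "norm x \<le> 1"
    then obtain y where y: "y \<in> \<Phi>" "blinfun_apply f \<bar>blinfun_apply T x - y\<bar> < e" using \<Phi> by blast
    let ?z = "blinfun_apply S x" and ?r = "\<bar>blinfun_apply T x - y\<bar>"
    have "0 \<le> u" unfolding u_def by (intro sum_nonneg) simp
    then have "inf ?z u \<in> {0..u}" using blinfun_nonneg[OF S(1) x(1)] by simp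
    moreover have "\<bar>?z - inf ?z u\<bar> \<le> ?r"
    proof -
      have "y \<le> u"
        unfolding u_def using sum_mono2[of \<Phi> "{y}" abs] \<Phi>(1) y(1) by (auto intro: order_trans[OF abs_ge_self])
      then have "blinfun_apply T x \<le> u + ?r"
        using add_mono[OF \<open>y \<le> u\<close> abs_ge_self[of "blinfun_apply T x - y"]] by simp
      then have "?z - ?r \<le> u"
        unfolding diff_le_eq by (rule order_trans[OF blinfun_mono_left[OF S(2) x(1)]])
      then have "?z - ?r \<le> inf ?z u" by simp
      then have "?z - inf ?z u \<le> ?r" by (simp only: diff_le_eq add.commute)
      moreover have "0 \<le> ?z - inf ?z u" by (simp del: diff_inf_eq_sup)
      ultimately show ?thesis by (simp add: abs_of_nonneg del: diff_inf_eq_sup)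
    qed
    then have "blinfun_apply f \<bar>?z - inf ?z u\<bar> < e"
      using blinfun_mono[OF f] y(2) by (meson le_less_trans)
    ultimately show "\<exists>k\<in>{0..u}. blinfun_apply f \<bar>?z - k\<bar> < e" by blast
  qed
qed

section \<open>Almost order boundedness of the unit ball\<close>

lemma decreasing_functionals_inf:
  fixes d :: "nat \<Rightarrow> 'a::banach_lattice dual"
  assumes "decseq d" and d0: "\<And>n. 0 \<le> d n"
  shows "\<exists>i. 0 \<le> i \<and> (\<forall>n. i \<le> d n) \<and>
    (\<forall>x\<ge>0. \<forall>e>0. \<exists>n. blinfun_apply (d n) x < blinfun_apply i x + e)"
proof -
  have "\<exists>i. 0 \<le> i \<and> (\<forall>c\<in>range d. i \<le> c) \<and>
    (\<forall>x\<ge>0. \<forall>e>0. \<exists>c\<in>range d. blinfun_apply c x < blinfun_apply i x + e)"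
  proof (rule directed_functionals_inf)
    fix a b assume "a \<in> range d" "b \<in> range d"
    then obtain n m where "a = d n" "b = d m" by blast
    then show "\<exists>c\<in>range d. c \<le> a \<and> c \<le> b"
      using decseqD[OF assms(1)] by (intro bexI[of _ "d (max n m)"]) auto
  qed (use d0 in auto)
  then show ?thesis by simp
qed

text \<open>If the claim fails, there are \<open>0 \<le> g n \<le> \<phi>\<close> with \<open>g n (x n) > e\<close> although \<open>g n (x k)\<close> is tiny
  for \<open>k < n\<close>; the limit superior of \<open>g\<close> is then approached in order but not in norm.\<close>

lemma order_continuous_dual_norm_almost_order_bounded:
  fixes \<phi> :: "'e::banach_lattice dual"
  assumes oc: "order_continuous_norm TYPE('e dual)" and \<phi>: "0 \<le> \<phi>" and e: "0 < e"
  shows "\<exists>u\<ge>0. \<forall>x\<ge>0. norm x \<le> 1 \<longrightarrow> blinfun_apply \<phi> (pprt (x - u)) \<le> e"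
proof (rule ccontr)
  assume neg: "\<not> ?thesis"
  \<comment> \<open>The negated claim is applied to \<open>2 ^ n\<close> times the sum of the
    vectors chosen so far; the growing factor makes the values \<open>g n (x k)\<close> with
    \<open>k < n\<close> decay geometrically.\<close>
  define P where "P f n r \<longleftrightarrow> 0 \<le> r \<and> norm r \<le> 1 \<and>
    e < blinfun_apply \<phi> (pprt (r - 2 ^ n *\<^sub>R (\<Sum>k<n. f k)))" for f :: "nat \<Rightarrow> 'e" and n r
  have "\<exists>x. \<forall>n. P x n (x n)"
  proof (rule dependent_wellorder_choice)
    show "P f n r = P g n r" if "\<And>k. k < n \<Longrightarrow> f k = g k" for r f g and n
    proof -
      have "(\<Sum>k<n. f k) = (\<Sum>k<n. g k)" using that by (intro sum.cong) auto
      then show ?thesis by (simp add: P_def)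
    qed
    fix n f assume "\<And>k. k < n \<Longrightarrow> P f k (f k)"
    then have "0 \<le> 2 ^ n *\<^sub>R (\<Sum>k<n. f k)"
      by (intro scaleR_nonneg_nonneg sum_nonneg) (auto simp: P_def)
    then show "\<exists>r. P f n r" using neg unfolding P_def by (meson not_le)
  qed
  then obtain x where x: "\<And>n. P x n (x n)" by blast
  define u where "u n = 2 ^ n *\<^sub>R (\<Sum>k<n. x k)" for n
  have x0: "0 \<le> x n" and x1: "norm (x n) \<le> 1" for n using x[of n] by (auto simp: P_def)
  have "\<exists>g. 0 \<le> g \<and> g \<le> \<phi> \<and> e < blinfun_apply g (x n - u n)" for n
    using functional_pprt_attained[OF \<phi>, of "x n - u n"] x[of n] unfolding P_def u_def by metis
  then obtain g where g: "\<And>n. 0 \<le> g n" "\<And>n. g n \<le> \<phi>" "\<And>n. e < blinfun_apply (g n) (x n - u n)"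
    by metis
  have u0: "0 \<le> u n" for n unfolding u_def by (intro scaleR_nonneg_nonneg sum_nonneg x0) auto
  have gx: "e < blinfun_apply (g n) (x n)" for n
    using g(3)[of n] blinfun_nonneg[OF g(1) u0, of n n] by (simp add: blinfun.diff_right)
  have small: "blinfun_apply (g n) (x k) \<le> norm \<phi> * (1/2) ^ n" if "k < n" for n k
  proof -
    have "x k \<le> (\<Sum>k<n. x k)" using sum_mono2[of "{..<n}" "{k}" x] x0 that by auto
    then have "2 ^ n *\<^sub>R x k \<le> u n" unfolding u_def by (intro scaleR_left_mono) auto
    then have "2 ^ n * blinfun_apply (g n) (x k) \<le> blinfun_apply (g n) (u n)"
      using blinfun_mono[OF g(1)] by (metis blinfun.scaleR_right real_scaleR_def)
    also have "\<dots> \<le> blinfun_apply (g n) (x n)" using g(3)[of n] e by (simp add: blinfun.diff_right)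
    also have "\<dots> \<le> blinfun_apply \<phi> (x n)" by (rule blinfun_mono_left[OF g(2) x0])
    also have "\<dots> \<le> norm \<phi> * 1"
      using functional_le_norm[of \<phi> "x n"] x1[of n] by (meson mult_left_mono norm_ge_zero order_trans)
    finally show ?thesis by (simp add: field_simps)
  qed
  \<comment> \<open>The truncated sum replaces the supremum of \<open>g n\<close>, ...,
    \<open>g N\<close>: it dominates each of them, stays below \<open>\<phi>\<close>, and is easy to
    estimate at \<open>x k\<close>.\<close>
  define s where "s n N = inf \<phi> (\<Sum>m\<in>{n..N}. g m)" for n N
  have s0: "0 \<le> s n N" for n N unfolding s_def by (simp add: \<phi> g sum_nonneg)
  have s_le: "s n N \<le> \<phi>" for n N unfolding s_def by simp
  have s_inc: "s n N \<le> s n M" if "N \<le> M" for n N M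
    unfolding s_def using that g by (intro inf_mono order_refl sum_mono2) auto
  have s_dec: "s m N \<le> s n N" if "n \<le> m" for n m N
    unfolding s_def using that g by (intro inf_mono order_refl sum_mono2) auto
  \<comment> \<open>The supremum over \<open>N\<close> is obtained as \<open>\<phi>\<close> minus
    the infimum of the decreasing sequence \<open>\<phi> - s n N\<close>.\<close>
  have "\<exists>G. 0 \<le> G \<and> (\<forall>N. s n N \<le> G) \<and>
    (\<forall>z\<ge>0. \<forall>d>0. \<exists>N. blinfun_apply G z < blinfun_apply (s n N) z + d)" for n
  proof -
    have "decseq (\<lambda>N. \<phi> - s n N)" by (simp add: decseq_def s_inc)
    moreover have "0 \<le> \<phi> - s n N" for N by (simp add: s_le)
    ultimately obtain i where i: "0 \<le> i" "\<And>N. i \<le> \<phi> - s n N"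
      "\<And>z d. 0 \<le> z \<Longrightarrow> 0 < d \<Longrightarrow> \<exists>N. blinfun_apply (\<phi> - s n N) z < blinfun_apply i z + d"
      using decreasing_functionals_inf[of "\<lambda>N. \<phi> - s n N"] by blast
    show ?thesis
    proof (intro exI[of _ "\<phi> - i"] conjI allI impI)
      show le: "s n N \<le> \<phi> - i" for N using i(2)[of N] by (simp add: algebra_simps)
      show "0 \<le> \<phi> - i" using s0 le by (rule order_trans)
      show "\<exists>N. blinfun_apply (\<phi> - i) z < blinfun_apply (s n N) z + d" if "0 \<le> z" "0 < d" for z d
        using i(3)[OF that] by (auto simp: blinfun.diff_left algebra_simps)
    qed
  qed
  then obtain G where G: "\<And>n. 0 \<le> G n" "\<And>n N. s n N \<le> G n"
    "\<And>n z d. 0 \<le> z \<Longrightarrow> 0 < d \<Longrightarrow> \<exists>N. blinfun_apply (G n) z < blinfun_apply (s n N) z + d"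
    by metis
  have G_le: "blinfun_apply (G n) z \<le> c" if z: "0 \<le> z" and c: "\<And>N. blinfun_apply (s n N) z \<le> c" for n z c
  proof (rule field_le_epsilon)
    fix d :: real assume "0 < d"
    then obtain N where "blinfun_apply (G n) z < blinfun_apply (s n N) z + d" using G(3)[OF z] by blast
    then show "blinfun_apply (G n) z \<le> c + d" using c[of N] by simp
  qed
  have dec: "decseq G"
    unfolding decseq_def less_eq_blinfun_def[of "G _"]
    by (intro allI impI G_le blinfun_mono_left[OF order_trans[OF s_dec G(2)]])
  then obtain I where I: "0 \<le> I" "\<And>n. I \<le> G n"
    "\<And>z d. 0 \<le> z \<Longrightarrow> 0 < d \<Longrightarrow> \<exists>n. blinfun_apply (G n) z < blinfun_apply I z + d"
    using decreasing_functionals_inf[OF dec G(1)] by blast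
  \<comment> \<open>For \<open>n > k\<close> the value of \<open>G n\<close> at \<open>x k\<close>
    is at most \<open>norm \<phi>\<close> times a tail of the geometric series.\<close>
  have Ix: "blinfun_apply I (x k) \<le> 0" for k
  proof (rule LIMSEQ_le_const)
    show "(\<lambda>n. norm \<phi> * (2 * (1/2) ^ n)) \<longlonglongrightarrow> 0"
      by (intro tendsto_mult_right_zero LIMSEQ_power_zero) simp
    show "\<exists>M. \<forall>n\<ge>M. blinfun_apply I (x k) \<le> norm \<phi> * (2 * (1/2) ^ n)"
    proof (intro exI[of _ "Suc k"] allI impI)
      fix n assume n: "Suc k \<le> n"
      have "blinfun_apply I (x k) \<le> blinfun_apply (G n) (x k)" by (rule blinfun_mono_left[OF I(2) x0])
      also have "\<dots> \<le> norm \<phi> * (2 * (1/2) ^ n)"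
      proof (rule G_le[OF x0])
        fix N
        have "blinfun_apply (s n N) (x k) \<le> blinfun_apply (\<Sum>m\<in>{n..N}. g m) (x k)"
          unfolding s_def by (rule blinfun_mono_left[OF inf_le2 x0])
        also have "\<dots> = (\<Sum>m\<in>{n..N}. blinfun_apply (g m) (x k))" by (simp add: blinfun.sum_left)
        also have "\<dots> \<le> (\<Sum>m\<in>{n..N}. norm \<phi> * (1/2) ^ m)" using n by (intro sum_mono small) auto
        also have "\<dots> = norm \<phi> * (\<Sum>m\<in>{n..N}. (1/2) ^ m)" by (simp add: sum_distrib_left)
        also have "\<dots> \<le> norm \<phi> * (2 * (1/2) ^ n)"
          by (intro mult_left_mono) (auto simp: sum_gp)
        finally show "blinfun_apply (s n N) (x k) \<le> norm \<phi> * (2 * (1/2) ^ n)" .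
      qed
      finally show "blinfun_apply I (x k) \<le> norm \<phi> * (2 * (1/2) ^ n)" .
    qed
  qed
  \<comment> \<open>These differences decrease to 0, so order continuity makes some
    \<open>norm (G n - I)\<close> smaller than \<open>e\<close>. But the value of
    \<open>G n - I\<close> at \<open>x n\<close> exceeds \<open>e\<close>, because
    \<open>G n \<ge> g n\<close> and \<open>I (x n) \<le> 0\<close>.\<close>
  define D where "D = range (\<lambda>n. G n - I)"
  have "\<exists>a\<in>D. \<forall>b\<in>D. b \<le> a \<longrightarrow> norm b < e"
  proof (rule oc[unfolded order_continuous_norm_def, rule_format, OF _ e], intro conjI ballI allI impI)
    show "D \<noteq> {}" by (simp add: D_def)
    show "0 \<le> a" if "a \<in> D" for a using that I(2) by (auto simp: D_def)
    show "\<exists>c\<in>D. c \<le> a \<and> c \<le> b" if ab: "a \<in> D" "b \<in> D" for a b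
    proof -
      obtain n m where "a = G n - I" "b = G m - I" using ab unfolding D_def by blast
      then show ?thesis
        using decseqD[OF dec] by (intro bexI[of _ "G (max n m) - I"]) (auto simp: D_def)
    qed
    fix l assume l: "\<forall>a\<in>D. l \<le> a"
    show "l \<le> 0" unfolding less_eq_blinfun_def
    proof (intro allI impI)
      fix z :: 'e assume z: "0 \<le> z"
      show "blinfun_apply l z \<le> blinfun_apply 0 z"
      proof (rule field_le_epsilon)
        fix d :: real assume d: "0 < d"
        obtain n where n: "blinfun_apply (G n) z < blinfun_apply I z + d" using I(3)[OF z d] by blast
        have "l \<le> G n - I" using l unfolding D_def by blast
        from blinfun_mono_left[OF this z]
        show "blinfun_apply l z \<le> blinfun_apply 0 z + d" using n by (simp add: blinfun.diff_left)
      qed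
    qed
  qed
  then obtain n where n: "norm (G n - I) < e" by (auto simp: D_def)
  have "s n n = g n" unfolding s_def using g(2) by (simp add: inf.absorb2)
  then have "e < blinfun_apply (G n) (x n)"
    using gx[of n] blinfun_mono_left[OF G(2)[of n n] x0[of n]] by simp
  then have "e < blinfun_apply (G n - I) (x n)" using Ix[of n] by (simp add: blinfun.diff_left)
  also have "\<dots> \<le> norm (G n - I) * 1"
    using functional_le_norm[of "G n - I" "x n"] x1[of n] by (meson mult_left_mono norm_ge_zero order_trans)
  finally show False using n by simp
qed

text \<open>Monotonicity gives \<open>\<le>\<close> for all nonnegative scalars; for
  \<open>c > 0\<close> the converse is the same inequality for \<open>inverse c\<close>.\<close>

lemma abs_scaleR_nonneg:
  fixes v :: "'a::banach_lattice"
  assumes "0 \<le> c"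
  shows "\<bar>c *\<^sub>R v\<bar> = c *\<^sub>R \<bar>v\<bar>"
proof (cases "c = 0")
  case False
  then have c: "0 < c" using assms by simp
  have le: "\<bar>t *\<^sub>R w\<bar> \<le> t *\<^sub>R \<bar>w\<bar>" if "0 \<le> t" for t and w :: 'a
  proof (rule abs_leI)
    show "t *\<^sub>R w \<le> t *\<^sub>R \<bar>w\<bar>" using that by (intro scaleR_left_mono abs_ge_self)
    have "t *\<^sub>R (- w) \<le> t *\<^sub>R \<bar>w\<bar>" using that by (intro scaleR_left_mono abs_ge_minus_self)
    then show "- (t *\<^sub>R w) \<le> t *\<^sub>R \<bar>w\<bar>" by simp
  qed
  have "c *\<^sub>R \<bar>inverse c *\<^sub>R (c *\<^sub>R v)\<bar> \<le> c *\<^sub>R (inverse c *\<^sub>R \<bar>c *\<^sub>R v\<bar>)"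
    using c by (intro scaleR_left_mono le) auto
  then show ?thesis using c le[OF assms, of v] by simp
qed simp

lemma diff_inf_eq_pprt: "x - inf x u = pprt (x - u)" for x u :: "'a::banach_lattice"
  by (simp add: pprt_def add_sup_distrib_left sup.commute)

text \<open>Almost order boundedness of the ball for \<open>f o\<^sub>L T\<close> gives
  \<open>u\<close> with \<open>f (T (pprt (x - u)))\<close> small. Replacing \<open>x\<close> by
  \<open>inf x u\<close> changes \<open>S x\<close> by
  \<open>S (pprt (x - u)) \<le> T (pprt (x - u))\<close>, so only the image of \<open>{0..u}\<close>
  under \<open>S\<close> remains.\<close>

lemma dominated_PL_compact_if_dual_norm_order_continuous:
  fixes S T :: "'e::banach_lattice \<Rightarrow>\<^sub>L 'f::banach_lattice"
  assumes S: "0 \<le> S" "S \<le> T" and T: "PL_compact T"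
    and oc: "order_continuous_norm TYPE('e dual)"
  shows "PL_compact S"
  unfolding PL_compact_def abs_weakly_totally_bounded_iff
proof (intro allI impI ball_image_totally_boundedI)
  fix f :: "'f dual" and e :: real assume f: "0 \<le> f" and e: "0 < e"
  have T0: "0 \<le> T" using S by (rule order_trans)
  have Tball: "seminorm_totally_bounded f (blinfun_apply T ` cball 0 1)"
    using T f by (simp add: PL_compact_def abs_weakly_totally_bounded_iff)
  have "0 \<le> f o\<^sub>L T"
    unfolding less_eq_blinfun_def by (simp add: blinfun_nonneg f T0)
  from order_continuous_dual_norm_almost_order_bounded[OF oc this, of "e / 2"] e
  obtain u where u: "0 \<le> u"
    "\<And>x. 0 \<le> x \<Longrightarrow> norm x \<le> 1 \<Longrightarrow> blinfun_apply f (blinfun_apply T (pprt (x - u))) \<le> e / 2"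
    by auto
  have "seminorm_totally_bounded f (blinfun_apply T ` {0..u})"
  proof (rule seminorm_totally_bounded_imageI)
    fix d :: real assume d: "0 < d"
    \<comment> \<open>Scaling by \<open>inverse r\<close> carries \<open>{0..u}\<close> into the
      ball; the summand 1 keeps \<open>r\<close> positive for \<open>u = 0\<close>.\<close>
    define r where "r = norm u + 1"
    have r: "0 < r" by (simp add: r_def add_nonneg_pos)
    obtain c :: "'f \<Rightarrow> 'f" where c: "finite (c ` blinfun_apply T ` cball 0 1)"
      "\<And>x y. x \<in> blinfun_apply T ` cball 0 1 \<Longrightarrow> y \<in> blinfun_apply T ` cball 0 1 \<Longrightarrow> c x = c y \<Longrightarrow>
        blinfun_apply f \<bar>x - y\<bar> < d / r"
      by (rule seminorm_totally_bounded_colouring[OF Tball f divide_pos_pos[OF d r]]) blast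
    define C where "C x = c (blinfun_apply T (inverse r *\<^sub>R x))" for x
    have ball: "inverse r *\<^sub>R x \<in> cball 0 1" if "x \<in> {0..u}" for x
      using norm_mono_nonneg[of x u] that r by (simp add: r_def field_simps)
    have "C ` {0..u} \<subseteq> c ` blinfun_apply T ` cball 0 1"
      using ball by (auto simp: C_def)
    then have "finite (C ` {0..u})" using c(1) by (rule finite_subset)
    moreover have "blinfun_apply f \<bar>blinfun_apply T x - blinfun_apply T y\<bar> < d"
      if "x \<in> {0..u}" "y \<in> {0..u}" "C x = C y" for x y
    proof -
      let ?v = "blinfun_apply T x - blinfun_apply T y"
      have "\<bar>?v\<bar> = r *\<^sub>R \<bar>inverse r *\<^sub>R ?v\<bar>"
        using r abs_scaleR_nonneg[of r "inverse r *\<^sub>R ?v"] by simp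
      then have "blinfun_apply f \<bar>?v\<bar> = r * blinfun_apply f \<bar>inverse r *\<^sub>R ?v\<bar>"
        by (metis blinfun.scaleR_right real_scaleR_def)
      moreover have "blinfun_apply f \<bar>inverse r *\<^sub>R ?v\<bar> < d / r"
        using c(2)[OF imageI imageI, OF ball ball, OF that(1,2)] that(3)
        by (simp add: C_def blinfun.scaleR_right scaleR_diff_right)
      ultimately show ?thesis using r by (simp add: field_simps)
    qed
    ultimately show "\<exists>C :: 'e \<Rightarrow> 'f. finite (C ` {0..u}) \<and> (\<forall>x\<in>{0..u}. \<forall>y\<in>{0..u}. C x = C y \<longrightarrow>
        blinfun_apply f \<bar>blinfun_apply T x - blinfun_apply T y\<bar> < d)"
      by (intro exI[of _ C]) blast
  qed
  then have K: "seminorm_totally_bounded f (blinfun_apply S ` {0..u})"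
    by (rule dominated_interval_image_totally_bounded[OF S f u(1)])
  show "\<exists>K. seminorm_totally_bounded f K \<and>
    (\<forall>x\<ge>0. norm x \<le> 1 \<longrightarrow> (\<exists>k\<in>K. blinfun_apply f \<bar>blinfun_apply S x - k\<bar> < e))"
  proof (intro exI[of _ "blinfun_apply S ` {0..u}"] conjI K allI impI)
    fix x :: 'e assume x: "0 \<le> x" "norm x \<le> 1"
    let ?p = "pprt (x - u)"
    have "blinfun_apply S x - blinfun_apply S (inf x u) = blinfun_apply S ?p"
      by (simp flip: blinfun.diff_right diff_inf_eq_pprt del: diff_inf_eq_sup)
    then have "blinfun_apply f \<bar>blinfun_apply S x - blinfun_apply S (inf x u)\<bar> =
        blinfun_apply f (blinfun_apply S ?p)"
      using blinfun_nonneg[OF S(1), of ?p] by (simp add: abs_of_nonneg)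
    also have "\<dots> \<le> blinfun_apply f (blinfun_apply T ?p)"
      by (intro blinfun_mono[OF f] blinfun_mono_left[OF S(2)] zero_le_pprt)
    also have "\<dots> < e" using u(2)[OF x] e by simp
    finally show "\<exists>k\<in>blinfun_apply S ` {0..u}. blinfun_apply f \<bar>blinfun_apply S x - k\<bar> < e"
      using x u by (intro bexI[of _ "blinfun_apply S (inf x u)"]) auto
  qed
qed

section \<open>A dominated operator that is not PL-compact\<close>

text \<open>A set refuting order continuity consists of functionals with norms bounded away from 0,
  yet its pointwise infimum on the cone is 0. So one alternates: pick a vector where the current
  functional is large, then descend until the value there is at most \<open>\<eta>\<close>. Fixing
  \<open>e\<close> before \<open>\<eta>\<close> lets \<open>\<eta>\<close> depend on it.\<close>

lemma not_order_continuous_dual_norm_sequence: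
  assumes "\<not> order_continuous_norm TYPE('e::banach_lattice dual)"
  obtains e where "0 < e" "\<And>\<eta>. 0 < \<eta> \<Longrightarrow> \<exists>(d :: nat \<Rightarrow> 'e dual) x. \<forall>n. 0 \<le> d n \<and> d (Suc n) \<le> d n \<and>
    0 \<le> x n \<and> norm (x n) \<le> 1 \<and> e < blinfun_apply (d n) (x n) \<and> blinfun_apply (d (Suc n)) (x n) \<le> \<eta>"
proof -
  obtain D :: "'e dual set" and e where D: "D \<noteq> {} \<and> (\<forall>x\<in>D. \<forall>y\<in>D. \<exists>z\<in>D. z \<le> x \<and> z \<le> y) \<and>
      (\<forall>x\<in>D. 0 \<le> x) \<and> (\<forall>l. (\<forall>x\<in>D. l \<le> x) \<longrightarrow> l \<le> 0)"
    and e: "0 < e" and far: "\<not> (\<exists>x\<in>D. \<forall>y\<in>D. y \<le> x \<longrightarrow> norm y < e)"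
    using assms unfolding order_continuous_norm_def not_all not_imp
    by (elim exE conjE) (rule that, intro conjI; assumption)
  have ne: "D \<noteq> {}" and dir: "\<And>a b. a \<in> D \<Longrightarrow> b \<in> D \<Longrightarrow> \<exists>c\<in>D. c \<le> a \<and> c \<le> b"
    and D0: "\<And>a. a \<in> D \<Longrightarrow> 0 \<le> a" using D by simp_all
  have lower: "l \<le> 0" if "\<And>a. a \<in> D \<Longrightarrow> l \<le> a" for l using D that by simp
  \<comment> \<open>Below \<open>a\<close> there is some element of norm at least \<open>e\<close>,
    and the norm is monotone on the cone.\<close>
  have norm: "e \<le> norm a" if a: "a \<in> D" for a
  proof -
    obtain b where b: "b \<in> D" "b \<le> a" "e \<le> norm b" using far a by (meson not_le)
    show ?thesis using norm_mono_nonneg[OF D0[OF b(1)] b(2)] b(3) by simp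
  qed
  have small: "\<exists>a\<in>D. blinfun_apply a x \<le> \<eta>" if "0 \<le> x" "0 < \<eta>" for x \<eta>
  proof -
    obtain i where i: "0 \<le> i" "\<And>a. a \<in> D \<Longrightarrow> i \<le> a"
      "\<And>x e. 0 \<le> x \<Longrightarrow> 0 < e \<Longrightarrow> \<exists>a\<in>D. blinfun_apply a x < blinfun_apply i x + e"
      using directed_functionals_inf[OF ne dir D0] by blast
    have "i = 0" using i(1) lower[OF i(2)] by (rule order.antisym[rotated])
    then show ?thesis using i(3)[OF that] by (auto intro: less_imp_le)
  qed
  show thesis
  proof
    show "0 < e / 2" using e by simp
    fix \<eta> :: real assume \<eta>: "0 < \<eta>"
    define Q where "Q a b x \<longleftrightarrow> b \<le> a \<and> 0 \<le> x \<and> norm x \<le> 1 \<and> e / 2 < blinfun_apply a x \<and>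
      blinfun_apply b x \<le> \<eta>" for a b :: "'e dual" and x
    have "\<exists>d. \<forall>n. d n \<in> D \<and> (\<exists>x. Q (d n) (d (Suc n)) x)"
    proof (rule dependent_nat_choice)
      show "\<exists>a. a \<in> D" using ne by blast
      fix a assume a: "a \<in> D"
      obtain x where x: "0 \<le> x" "norm x \<le> 1" "e / 2 < blinfun_apply a x"
        using positive_functional_norm_attained[OF D0[OF a] e norm[OF a]] by blast
      obtain b where b: "b \<in> D" "blinfun_apply b x \<le> \<eta>" using small[OF x(1) \<eta>] by blast
      obtain c where c: "c \<in> D" "c \<le> a" "c \<le> b" using dir[OF a b(1)] by blast
      have "blinfun_apply c x \<le> \<eta>" using blinfun_mono_left[OF c(3) x(1)] b(2) by simp
      then have "Q a c x" using x c by (simp add: Q_def)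
      then show "\<exists>b. b \<in> D \<and> (\<exists>x. Q a b x)" using c(1) by blast
    qed
    then obtain d x where "\<And>n. d n \<in> D" "\<And>n. Q (d n) (d (Suc n)) (x n)" by metis
    then show "\<exists>(d :: nat \<Rightarrow> 'e dual) x. \<forall>n. 0 \<le> d n \<and> d (Suc n) \<le> d n \<and>
      0 \<le> x n \<and> norm (x n) \<le> 1 \<and> e / 2 < blinfun_apply (d n) (x n) \<and> blinfun_apply (d (Suc n)) (x n) \<le> \<eta>"
      using D0 unfolding Q_def by blast
  qed
qed

text \<open>If for every \<open>e\<close> the set \<open>A\<close> were within \<open>e / 3\<close>
  of some totally bounded set, the colours of nearby points would show that \<open>A\<close> is
  totally bounded. The gap holds for all totally bounded \<open>K\<close>, so that compact sets can
  be avoided later.\<close>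

lemma not_totally_bounded_separated:
  fixes f :: "'a::banach_lattice dual"
  assumes A: "\<not> seminorm_totally_bounded f A" and f: "0 \<le> f"
  obtains \<delta> where "0 < \<delta>" "\<And>K. seminorm_totally_bounded f K \<Longrightarrow> \<exists>z\<in>A. \<forall>k\<in>K. \<delta> \<le> blinfun_apply f \<bar>z - k\<bar>"
proof -
  have "\<exists>\<delta>>0. \<forall>K. seminorm_totally_bounded f K \<longrightarrow> (\<exists>z\<in>A. \<forall>k\<in>K. \<delta> \<le> blinfun_apply f \<bar>z - k\<bar>)"
  proof (rule ccontr)
    assume neg: "\<not> ?thesis"
    have "seminorm_totally_bounded f A"
    proof (rule seminorm_totally_boundedI)
      fix e :: real assume "0 < e"
      then have e: "0 < e / 3" by simp
      then obtain K where K: "seminorm_totally_bounded f K"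
        "\<And>z. z \<in> A \<Longrightarrow> \<exists>k\<in>K. blinfun_apply f \<bar>z - k\<bar> < e / 3"
        using neg by (meson not_le)
      obtain c :: "'a \<Rightarrow> 'a" where c: "finite (c ` K)"
        "\<And>x y. x \<in> K \<Longrightarrow> y \<in> K \<Longrightarrow> c x = c y \<Longrightarrow> blinfun_apply f \<bar>x - y\<bar> < e / 3"
        by (rule seminorm_totally_bounded_colouring[OF K(1) f e]) blast
      obtain p where p: "\<And>z. z \<in> A \<Longrightarrow> p z \<in> K" "\<And>z. z \<in> A \<Longrightarrow> blinfun_apply f \<bar>z - p z\<bar> < e / 3"
        using K(2) by metis
      have "(\<lambda>z. c (p z)) ` A \<subseteq> c ` K" using p(1) by blast
      then have "finite ((\<lambda>z. c (p z)) ` A)" using c(1) by (rule finite_subset)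
      moreover have "blinfun_apply f \<bar>x - y\<bar> < e" if "x \<in> A" "y \<in> A" "c (p x) = c (p y)" for x y
        using functional_abs_diff_triangle[OF f, of x y "p x"]
          functional_abs_diff_triangle[OF f, of y "p x" "p y"]
          p(2)[OF that(1)] p(2)[OF that(2)] c(2)[OF p(1) p(1), OF that] by linarith
      ultimately show "\<exists>c :: 'a \<Rightarrow> 'a. finite (c ` A) \<and>
        (\<forall>x\<in>A. \<forall>y\<in>A. c x = c y \<longrightarrow> blinfun_apply f \<bar>x - y\<bar> < e)"
        by (intro exI[of _ "\<lambda>z. c (p z)"]) blast
    qed
    then show False using A by contradiction
  qed
  then show thesis using that by blast
qed

section \<open>Bounded combinations and telescoping series\<close>

text \<open>Induction on \<open>n\<close>: the new combinations lie in the image of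
  \<open>K \<times> {-M..M}\<close> under a continuous map.\<close>

lemma bounded_combinations_compact:
  fixes y :: "nat \<Rightarrow> 'a::real_normed_vector"
  shows "\<exists>K. compact K \<and> (\<forall>a. (\<forall>i<n. \<bar>a i\<bar> \<le> M) \<longrightarrow> (\<Sum>i<n. a i *\<^sub>R y i) \<in> K)"
proof (induction n)
  case (Suc n)
  then obtain K where K: "compact K" "\<And>a. (\<forall>i<n. \<bar>a i\<bar> \<le> M) \<Longrightarrow> (\<Sum>i<n. a i *\<^sub>R y i) \<in> K"
    by blast
  let ?g = "\<lambda>p. fst p + snd p *\<^sub>R y n"
  show ?case
  proof (intro exI[of _ "?g ` (K \<times> {-M..M})"] conjI allI impI)
    show "compact (?g ` (K \<times> {-M..M}))"
      by (intro compact_continuous_image continuous_intros compact_Times K(1) compact_Icc)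
    fix a :: "nat \<Rightarrow> real" assume a: "\<forall>i<Suc n. \<bar>a i\<bar> \<le> M"
    then have "\<bar>a n\<bar> \<le> M" by blast
    then show "(\<Sum>i<Suc n. a i *\<^sub>R y i) \<in> ?g ` (K \<times> {-M..M})"
      using K(2)[of a] a by (intro image_eqI[of _ _ "(\<Sum>i<n. a i *\<^sub>R y i, a n)"]) auto
  qed
qed (auto intro: exI[of _ "{0}"])

text \<open>\<open>S z\<close> is the sum of all \<open>(d m - d (Suc m)) z *\<^sub>R Y m\<close>.
  On the cone the coefficients telescope to a sum of at most \<open>d 0 z\<close>, which gives
  absolute convergence, and the tail from \<open>N\<close> on lies between 0 and
  \<open>d N z *\<^sub>R y\<close>. The case \<open>N = 0\<close> is positivity and
  domination.\<close>

lemma bounded_linear_telescoping_series: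
  fixes d :: "nat \<Rightarrow> 'e::banach_lattice dual" and Y :: "nat \<Rightarrow> 'f::banach_lattice"
  assumes d0: "\<And>n. 0 \<le> d n" and dec: "\<And>n. d (Suc n) \<le> d n"
    and Y: "\<And>n. 0 \<le> Y n" "\<And>n. Y n \<le> y"
  obtains S :: "'e \<Rightarrow>\<^sub>L 'f" where "\<And>z N. 0 \<le> z \<Longrightarrow>
      (\<Sum>m<N. blinfun_apply (d m - d (Suc m)) z *\<^sub>R Y m) \<le> blinfun_apply S z"
    "\<And>z N. 0 \<le> z \<Longrightarrow> blinfun_apply S z \<le>
      (\<Sum>m<N. blinfun_apply (d m - d (Suc m)) z *\<^sub>R Y m) + blinfun_apply (d N) z *\<^sub>R y"
proof -
  define \<phi> where "\<phi> m = d m - d (Suc m)" for m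
  define t where "t z m = blinfun_apply (\<phi> m) z *\<^sub>R Y m" for z m
  have \<phi>0: "0 \<le> \<phi> m" for m by (simp add: \<phi>_def dec)
  have tele: "(\<Sum>m<p. blinfun_apply (\<phi> (N + m)) z) = blinfun_apply (d N) z - blinfun_apply (d (N + p)) z" for p N z
    by (induction p) (simp_all add: \<phi>_def blinfun.diff_left)
  have partial: "(\<Sum>m<p. blinfun_apply (\<phi> (N + m)) z) \<le> blinfun_apply (d N) z" if "0 \<le> z" for p N z
    unfolding tele using blinfun_nonneg[OF d0 that] by simp
  have sm: "summable (\<lambda>m. blinfun_apply (\<phi> m) z)" if "0 \<le> z" for z
    using blinfun_nonneg[OF \<phi>0 that] partial[OF that, where N = 0]
    by (intro summableI_nonneg_bounded[where x = "blinfun_apply (d 0) z"]) auto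
  have y0: "0 \<le> y" using Y by (meson order_trans)
  have nt: "norm (t z m) \<le> blinfun_apply (\<phi> m) \<bar>z\<bar> * norm y" for z m
    unfolding t_def norm_scaleR
    using abs_blinfun_apply_le[OF \<phi>0] norm_mono_nonneg[OF Y]
    by (intro mult_mono) (auto intro: blinfun_nonneg \<phi>0)
  have snorm: "summable (\<lambda>m. norm (t z m))" for z
    by (rule summable_comparison_test'[OF summable_mult2[OF sm[OF abs_ge_zero[of z]], of "norm y"]])
      (simp add: nt)
  then have st: "summable (t z)" for z by (rule summable_norm_cancel)
  have lin: "bounded_linear (\<lambda>z. suminf (t z))"
  proof (rule bounded_linear_intro)
    fix x z r
    show "suminf (t (x + z)) = suminf (t x) + suminf (t z)"
    proof -
      have "t (x + z) = (\<lambda>m. t x m + t z m)"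
        by (simp add: fun_eq_iff t_def blinfun.add_right scaleR_left_distrib)
      then show ?thesis by (simp add: suminf_add[OF st st])
    qed
    show "suminf (t (r *\<^sub>R x)) = r *\<^sub>R suminf (t x)"
    proof -
      have "t (r *\<^sub>R x) = (\<lambda>m. r *\<^sub>R t x m)" by (simp add: fun_eq_iff t_def blinfun.scaleR_right)
      then show ?thesis by (simp add: suminf_scaleR_right[OF st])
    qed
    have "norm (suminf (t x)) \<le> (\<Sum>m. norm (t x m))" by (rule summable_norm[OF snorm])
    also have "\<dots> \<le> (\<Sum>m. blinfun_apply (\<phi> m) \<bar>x\<bar> * norm y)"
      by (intro suminf_le nt snorm summable_mult2 sm) simp
    also have "\<dots> = (\<Sum>m. blinfun_apply (\<phi> m) \<bar>x\<bar>) * norm y"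
      by (rule suminf_mult2[symmetric]) (intro sm, simp)
    also have "\<dots> \<le> blinfun_apply (d 0) \<bar>x\<bar> * norm y"
      using partial[of "\<bar>x\<bar>" 0] by (intro mult_right_mono suminf_le_const sm) auto
    also have "\<dots> \<le> (norm (d 0) * norm x) * norm y"
      using functional_le_norm[of "d 0" "\<bar>x\<bar>"] by (intro mult_right_mono) auto
    finally show "norm (suminf (t x)) \<le> norm x * (norm (d 0) * norm y)" by (simp add: ac_simps)
  qed
  show thesis
  proof
    fix z :: 'e and N :: nat assume z: "0 \<le> z"
    let ?R = "\<lambda>p. \<Sum>m<p. t z (N + m)"
    have split: "suminf (t z) = (\<Sum>m. t z (N + m)) + (\<Sum>m<N. t z m)"
      using suminf_split_initial_segment[OF st, of z N] by (simp add: add.commute)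
    have lim: "?R \<longlonglongrightarrow> (\<Sum>m. t z (N + m))"
      using summable_LIMSEQ[of "\<lambda>m. t z (N + m)"] st[of z]
      by (simp add: add.commute[of N] summable_iff_shift)
    have t0: "0 \<le> t z m" for m
      unfolding t_def by (intro scaleR_nonneg_nonneg blinfun_nonneg[OF \<phi>0 z] Y)
    have "0 \<le> (\<Sum>m. t z (N + m))" by (rule nonneg_tendsto[OF lim]) (simp add: sum_nonneg t0)
    then show "(\<Sum>m<N. blinfun_apply (d m - d (Suc m)) z *\<^sub>R Y m) \<le> blinfun_apply (Blinfun (\<lambda>z. suminf (t z))) z"
      unfolding bounded_linear_Blinfun_apply[OF lin] split by (simp add: t_def \<phi>_def)
    have "?R p \<le> blinfun_apply (d N) z *\<^sub>R y" for p
    proof -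
      have "?R p \<le> (\<Sum>m<p. blinfun_apply (\<phi> (N + m)) z *\<^sub>R y)"
        unfolding t_def by (intro sum_mono scaleR_left_mono Y blinfun_nonneg[OF \<phi>0 z])
      also have "\<dots> = (\<Sum>m<p. blinfun_apply (\<phi> (N + m)) z) *\<^sub>R y" by (simp add: scaleR_sum_left)
      also have "\<dots> \<le> blinfun_apply (d N) z *\<^sub>R y" by (intro scaleR_right_mono partial z y0)
      finally show ?thesis .
    qed
    from tendsto_le_lattice[OF lim tendsto_const this]
    show "blinfun_apply (Blinfun (\<lambda>z. suminf (t z))) z \<le>
      (\<Sum>m<N. blinfun_apply (d m - d (Suc m)) z *\<^sub>R Y m) + blinfun_apply (d N) z *\<^sub>R y"
      unfolding bounded_linear_Blinfun_apply[OF lin] split by (simp add: t_def \<phi>_def)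
  qed
qed

text \<open>Instead of making the \<open>x n\<close> disjoint, \<open>Y n\<close> is chosen far from all bounded combinations of its
  predecessors; then only the functionals \<open>d m\<close> with \<open>m > n\<close> have to be small at \<open>x n\<close>.\<close>

lemma dominated_not_PL_compact:
  assumes E: "\<not> order_continuous_norm TYPE('e::banach_lattice dual)"
    and F: "\<not> abs_weakly_totally_bounded {a..b :: 'f::banach_lattice}"
  shows "\<exists>S T :: 'e \<Rightarrow>\<^sub>L 'f. 0 \<le> S \<and> S \<le> T \<and> PL_compact T \<and> \<not> PL_compact S"
proof -
  obtain f :: "'f dual" where f: "0 \<le> f" and nf: "\<not> seminorm_totally_bounded f {a..b}"
    using F unfolding abs_weakly_totally_bounded_iff by blast
  define y where "y = b - a"
  have "\<not> seminorm_totally_bounded f {0..y}"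
  proof
    assume tb: "seminorm_totally_bounded f {0..y}"
    have "seminorm_totally_bounded f {a..b}"
    proof (rule seminorm_totally_boundedI)
      fix e :: real assume e: "0 < e"
      obtain c :: "'f \<Rightarrow> 'f" where c: "finite (c ` {0..y})"
        "\<And>x z. x \<in> {0..y} \<Longrightarrow> z \<in> {0..y} \<Longrightarrow> c x = c z \<Longrightarrow> blinfun_apply f \<bar>x - z\<bar> < e"
        by (rule seminorm_totally_bounded_colouring[OF tb f e]) blast
      have sub: "x - a \<in> {0..y}" if "x \<in> {a..b}" for x using that by (simp add: y_def)
      have "(\<lambda>x. c (x - a)) ` {a..b} \<subseteq> c ` {0..y}" using sub by blast
      then have "finite ((\<lambda>x. c (x - a)) ` {a..b})" using c(1) by (rule finite_subset)
      moreover have "blinfun_apply f \<bar>x - z\<bar> < e"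
        if "x \<in> {a..b}" "z \<in> {a..b}" "c (x - a) = c (z - a)" for x z
        using c(2)[OF sub[OF that(1)] sub[OF that(2)] that(3)] by simp
      ultimately show "\<exists>c :: 'f \<Rightarrow> 'f. finite (c ` {a..b}) \<and>
        (\<forall>x\<in>{a..b}. \<forall>z\<in>{a..b}. c x = c z \<longrightarrow> blinfun_apply f \<bar>x - z\<bar> < e)"
        by (intro exI[of _ "\<lambda>x. c (x - a)"]) blast
    qed
    then show False using nf by contradiction
  qed
  then obtain \<delta> where \<delta>: "0 < \<delta>"
    "\<And>K. seminorm_totally_bounded f K \<Longrightarrow> \<exists>z\<in>{0..y}. \<forall>k\<in>K. \<delta> \<le> blinfun_apply f \<bar>z - k\<bar>"
    using not_totally_bounded_separated[OF _ f] by blast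
  have y0: "0 \<le> y"
  proof -
    \<comment> \<open>Avoiding the empty set already yields a point of \<open>{0..y}\<close>, so
      this interval is nonempty.\<close>
    have "seminorm_totally_bounded f {}" by (simp add: seminorm_totally_bounded_def)
    from \<delta>(2)[OF this] show ?thesis by (auto intro: order_trans)
  qed
  obtain e where e: "0 < e" and seq: "\<And>\<eta>. 0 < \<eta> \<Longrightarrow> \<exists>(d :: nat \<Rightarrow> 'e dual) x. \<forall>n. 0 \<le> d n \<and> d (Suc n) \<le> d n \<and>
    0 \<le> x n \<and> norm (x n) \<le> 1 \<and> e < blinfun_apply (d n) (x n) \<and> blinfun_apply (d (Suc n)) (x n) \<le> \<eta>"
    by (rule not_order_continuous_dual_norm_sequence[OF E]) blast
  have fy: "0 \<le> blinfun_apply f y" by (rule blinfun_nonneg[OF f y0])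
  \<comment> \<open>The first bound keeps the coefficient of \<open>Y n\<close> in
    \<open>S (x n)\<close> at least \<open>e / 2\<close>; the second keeps the contribution of the
    tails to at most half of \<open>e * \<delta> / 2\<close>.\<close>
  define \<eta> where "\<eta> = min (e / 2) (e * \<delta> / (4 * (blinfun_apply f y + 1)))"
  have \<eta>: "0 < \<eta>" "\<eta> \<le> e / 2" using e \<delta>(1) fy unfolding \<eta>_def by (simp, intro min.cobounded1)
  have \<eta>f: "\<eta> * blinfun_apply f y \<le> e * \<delta> / 4"
  proof -
    have "\<eta> * blinfun_apply f y \<le> \<eta> * (blinfun_apply f y + 1)" using \<eta> by simp
    also have "\<dots> \<le> e * \<delta> / (4 * (blinfun_apply f y + 1)) * (blinfun_apply f y + 1)"
      using fy by (intro mult_right_mono) (auto simp: \<eta>_def)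
    also have "\<dots> = e * \<delta> / 4" using fy by (simp add: field_simps)
    finally show ?thesis .
  qed
  obtain d :: "nat \<Rightarrow> 'e dual" and x where d0: "\<And>n. 0 \<le> d n" and dec: "\<And>n. d (Suc n) \<le> d n"
    and x: "\<And>n. 0 \<le> x n" "\<And>n. norm (x n) \<le> 1" and dx: "\<And>n. e < blinfun_apply (d n) (x n)"
    "\<And>n. blinfun_apply (d (Suc n)) (x n) \<le> \<eta>"
    using seq[OF \<eta>(1)] by blast
  \<comment> \<open>Bounds the coefficients \<open>a m\<close> used for the separation: their
    numerators are at most \<open>norm (d 0)\<close> in modulus, their denominator is at least
    \<open>e / 2\<close>.\<close>
  define M where "M = norm (d 0) / (e / 2)"
  define P where "P Y n r \<longleftrightarrow> r \<in> {0..y} \<and> (\<forall>a. (\<forall>i<n. \<bar>a i\<bar> \<le> M) \<longrightarrow>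
    \<delta> \<le> blinfun_apply f \<bar>r - (\<Sum>i<n. a i *\<^sub>R Y i)\<bar>)" for Y :: "nat \<Rightarrow> 'f" and n r
  have "\<exists>Y. \<forall>n. P Y n (Y n)"
  proof (rule dependent_wellorder_choice)
    show "P Y n r = P Z n r" if eq: "\<And>i. i < n \<Longrightarrow> Y i = Z i" for r Y Z and n
    proof -
      have "(\<Sum>i<n. a i *\<^sub>R Y i) = (\<Sum>i<n. a i *\<^sub>R Z i)" for a using eq by (intro sum.cong) auto
      then show ?thesis by (simp add: P_def)
    qed
    fix n and Y :: "nat \<Rightarrow> 'f"
    obtain K where K: "compact K" "\<And>a. (\<forall>i<n. \<bar>a i\<bar> \<le> M) \<Longrightarrow> (\<Sum>i<n. a i *\<^sub>R Y i) \<in> K"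
      using bounded_combinations_compact[of n M Y] by blast
    obtain z where "z \<in> {0..y}" "\<forall>k\<in>K. \<delta> \<le> blinfun_apply f \<bar>z - k\<bar>"
      using \<delta>(2)[OF compact_imp_seminorm_totally_bounded[OF K(1) f]] by blast
    then show "\<exists>r. P Y n r" using K(2) unfolding P_def by blast
  qed
  then obtain Y where "\<And>n. P Y n (Y n)" by blast
  then have Y: "0 \<le> Y n" "Y n \<le> y"
    and far: "(\<And>i. i < n \<Longrightarrow> \<bar>a i\<bar> \<le> M) \<Longrightarrow> \<delta> \<le> blinfun_apply f \<bar>Y n - (\<Sum>i<n. a i *\<^sub>R Y i)\<bar>" for n a
    by (simp_all add: P_def)
  obtain S :: "'e \<Rightarrow>\<^sub>L 'f" where S: "\<And>z N. 0 \<le> z \<Longrightarrow>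
      (\<Sum>m<N. blinfun_apply (d m - d (Suc m)) z *\<^sub>R Y m) \<le> blinfun_apply S z"
    "\<And>z N. 0 \<le> z \<Longrightarrow> blinfun_apply S z \<le>
      (\<Sum>m<N. blinfun_apply (d m - d (Suc m)) z *\<^sub>R Y m) + blinfun_apply (d N) z *\<^sub>R y"
    by (rule bounded_linear_telescoping_series[of d Y y, OF d0 dec Y]) blast
  define T where "T = blinfun_scaleR_left y o\<^sub>L d 0"
  have T: "blinfun_apply T z = blinfun_apply (d 0) z *\<^sub>R y" for z
    by (simp add: T_def)
  have "0 \<le> S" using S(1)[of _ 0] by (simp add: less_eq_blinfun_def)
  moreover have "S \<le> T" using S(2)[of _ 0] by (simp add: less_eq_blinfun_def T)
  moreover have "PL_compact T"
    unfolding PL_compact_def abs_weakly_totally_bounded_iff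
  proof (intro allI impI)
    fix f :: "'f dual" assume f: "0 \<le> f"
    let ?K = "(\<lambda>t. t *\<^sub>R y) ` {- norm (d 0)..norm (d 0)}"
    have "blinfun_apply T ` cball 0 1 \<subseteq> ?K"
    proof
      fix w assume "w \<in> blinfun_apply T ` cball 0 1"
      then obtain z where z: "w = blinfun_apply T z" "norm z \<le> 1" by auto
      have "\<bar>blinfun_apply (d 0) z\<bar> \<le> norm (d 0) * 1"
        using norm_blinfun[of "d 0" z] z(2) by (metis mult_left_mono norm_ge_zero order_trans real_norm_def)
      then show "w \<in> ?K" using z T by (auto intro!: image_eqI[of _ _ "blinfun_apply (d 0) z"])
    qed
    moreover have "compact ?K" by (intro compact_continuous_image continuous_intros compact_Icc)
    ultimately show "seminorm_totally_bounded f (blinfun_apply T ` cball 0 1)"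
      using compact_imp_seminorm_totally_bounded[OF _ f] seminorm_totally_bounded_subset[OF _ f] by blast
  qed
  moreover have "\<not> PL_compact S"
  proof
    assume "PL_compact S"
    then have tb: "seminorm_totally_bounded f (blinfun_apply S ` cball 0 1)"
      using f by (simp add: PL_compact_def abs_weakly_totally_bounded_iff)
    have pos: "0 < e * \<delta> / 4" using e \<delta> by simp
    have sep: "e * \<delta> / 4 \<le> blinfun_apply f \<bar>blinfun_apply S (x n) - blinfun_apply S (x k)\<bar>" if "k < n" for n k
    proof -
      define \<phi> where "\<phi> m = d m - d (Suc m)" for m
      define c where "c = blinfun_apply (\<phi> n) (x n)"
      have c: "e / 2 \<le> c" "0 < c" using dx[of n] \<eta> e by (simp_all add: c_def \<phi>_def blinfun.diff_left)
      define a where "a m = (blinfun_apply (\<phi> m) (x k) - blinfun_apply (\<phi> m) (x n)) / c" for m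
      \<comment> \<open>\<open>c *\<^sub>R v\<close> is the partial sum of \<open>S (x n)\<close> up
        to index \<open>n\<close> minus the partial sum of \<open>S (x k)\<close> below
        \<open>n\<close>.\<close>
      define v where "v = Y n - (\<Sum>m<n. a m *\<^sub>R Y m)"
      \<comment> \<open>The tail starts at \<open>Suc n\<close> for \<open>x n\<close>, where
        \<open>d n\<close> is still large, but already at \<open>n\<close> for \<open>x k\<close>,
        where \<open>d n\<close> is small because \<open>k < n\<close>.\<close>
      define r where "r = blinfun_apply S (x n) - (\<Sum>m<Suc n. blinfun_apply (\<phi> m) (x n) *\<^sub>R Y m)"
      define r' where "r' = blinfun_apply S (x k) - (\<Sum>m<n. blinfun_apply (\<phi> m) (x k) *\<^sub>R Y m)"
      have "decseq d" using dec by (rule decseq_SucI)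
      then have dle: "d m \<le> d l" if "l \<le> m" for l m using that by (rule decseqD)
      have \<phi>b: "0 \<le> blinfun_apply (\<phi> m) (x l)" "blinfun_apply (\<phi> m) (x l) \<le> norm (d 0)" for m l
      proof -
        show "0 \<le> blinfun_apply (\<phi> m) (x l)" by (intro blinfun_nonneg x) (simp add: \<phi>_def dec)
        have "blinfun_apply (\<phi> m) (x l) \<le> blinfun_apply (d m) (x l)"
          using blinfun_nonneg[OF d0 x(1), of "Suc m" l] by (simp add: \<phi>_def blinfun.diff_left)
        also have "\<dots> \<le> blinfun_apply (d 0) (x l)" by (intro blinfun_mono_left dle x) simp
        also have "\<dots> \<le> norm (d 0) * 1"
          using functional_le_norm[of "d 0" "x l"] x(2)[of l] by (meson mult_left_mono norm_ge_zero order_trans)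
        finally show "blinfun_apply (\<phi> m) (x l) \<le> norm (d 0)" by simp
      qed
      have "\<bar>a m\<bar> \<le> M" for m
      proof -
        have "\<bar>blinfun_apply (\<phi> m) (x k) - blinfun_apply (\<phi> m) (x n)\<bar> \<le> norm (d 0)"
          using \<phi>b[of m k] \<phi>b[of m n] by linarith
        then have "\<bar>a m\<bar> \<le> norm (d 0) / c" using c(2) by (simp add: a_def divide_right_mono)
        also have "\<dots> \<le> M" unfolding M_def using c e by (intro divide_left_mono) auto
        finally show ?thesis .
      qed
      then have fv: "\<delta> \<le> blinfun_apply f \<bar>v\<bar>" unfolding v_def by (rule far)
      have ca: "c *\<^sub>R (\<Sum>m<n. a m *\<^sub>R Y m) =
        (\<Sum>m<n. blinfun_apply (\<phi> m) (x k) *\<^sub>R Y m) - (\<Sum>m<n. blinfun_apply (\<phi> m) (x n) *\<^sub>R Y m)"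
        using c(2) by (simp add: a_def scaleR_sum_right scaleR_diff_left flip: sum_subtractf)
      have "blinfun_apply S (x n) - blinfun_apply S (x k) = c *\<^sub>R v + (r - r')"
        unfolding v_def scaleR_diff_right ca r_def r'_def by (simp add: c_def)
      then have "c *\<^sub>R v = (blinfun_apply S (x n) - blinfun_apply S (x k)) + (r' - r)" by simp
      then have "blinfun_apply f \<bar>c *\<^sub>R v\<bar> \<le>
          blinfun_apply f \<bar>blinfun_apply S (x n) - blinfun_apply S (x k)\<bar> + blinfun_apply f \<bar>r' - r\<bar>"
        using functional_abs_triangle[OF f] by metis
      moreover have "blinfun_apply f \<bar>r' - r\<bar> \<le> \<eta> * blinfun_apply f y"
      proof -
        have "0 \<le> r" using S(1)[OF x(1)[of n], of "Suc n"] by (simp add: r_def \<phi>_def)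
        have "0 \<le> r'" using S(1)[OF x(1)[of k], of n] by (simp add: r'_def \<phi>_def)
        have \<eta>y: "blinfun_apply (d p) (x l) *\<^sub>R y \<le> \<eta> *\<^sub>R y" if "Suc l \<le> p" for p l
          using blinfun_mono_left[OF dle[OF that] x(1)[of l]] dx(2)[of l] y0 by (intro scaleR_right_mono) auto
        have "r \<le> \<eta> *\<^sub>R y"
          unfolding r_def \<phi>_def diff_le_eq
          by (rule order_trans[OF S(2)[OF x(1)[of n], of "Suc n"]]) (simp add: \<eta>y)
        have "r' \<le> \<eta> *\<^sub>R y"
          unfolding r'_def \<phi>_def diff_le_eq
          by (rule order_trans[OF S(2)[OF x(1)[of k], of n]]) (use \<eta>y[of k n] that in simp)
        \<comment> \<open>Both tails lie between 0 and \<open>\<eta> *\<^sub>R y\<close>, so their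
          difference costs this bound once, not twice.\<close>
        have "\<bar>r' - r\<bar> \<le> \<eta> *\<^sub>R y"
          using \<open>0 \<le> r\<close> \<open>0 \<le> r'\<close> \<open>r \<le> \<eta> *\<^sub>R y\<close> \<open>r' \<le> \<eta> *\<^sub>R y\<close>
          by (intro abs_leI) (simp_all add: diff_le_eq add_increasing2)
        from blinfun_mono[OF f this] show ?thesis by (simp add: blinfun.scaleR_right)
      qed
      moreover have "e * \<delta> / 2 \<le> blinfun_apply f \<bar>c *\<^sub>R v\<bar>"
      proof -
        have "c *\<^sub>R \<bar>v\<bar> \<le> \<bar>c *\<^sub>R v\<bar>" using abs_scaleR_nonneg[of c v] c by simp
        from blinfun_mono[OF f this] have "c * blinfun_apply f \<bar>v\<bar> \<le> blinfun_apply f \<bar>c *\<^sub>R v\<bar>"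
          by (simp add: blinfun.scaleR_right)
        moreover have "e / 2 * \<delta> \<le> c * blinfun_apply f \<bar>v\<bar>" using c fv \<delta> by (intro mult_mono) auto
        ultimately show ?thesis by simp
      qed
      ultimately show ?thesis using \<eta>f by linarith
    qed
    obtain col :: "'f \<Rightarrow> 'f" where col: "finite (col ` blinfun_apply S ` cball 0 1)"
      "\<And>u v. u \<in> blinfun_apply S ` cball 0 1 \<Longrightarrow> v \<in> blinfun_apply S ` cball 0 1 \<Longrightarrow> col u = col v \<Longrightarrow>
        blinfun_apply f \<bar>u - v\<bar> < e * \<delta> / 4"
      by (rule seminorm_totally_bounded_colouring[OF tb f pos]) blast
    have mem: "blinfun_apply S (x n) \<in> blinfun_apply S ` cball 0 1" for n using x(2)[of n] by simp
    \<comment> \<open>Finitely many colours on infinitely many indices: two separated points must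
      share a colour.\<close>
    have "range (\<lambda>n. col (blinfun_apply S (x n))) \<subseteq> col ` blinfun_apply S ` cball 0 1" using mem by blast
    then have "finite (range (\<lambda>n. col (blinfun_apply S (x n))))" using col(1) by (rule finite_subset)
    then have "\<not> inj (\<lambda>n. col (blinfun_apply S (x n)))" using finite_imageD infinite_UNIV_nat by blast
    then obtain k n where "k < n" "col (blinfun_apply S (x k)) = col (blinfun_apply S (x n))"
      unfolding inj_def by (metis nat_neq_iff)
    then show False using col(2)[OF mem mem, of n k] sep[of k n] by simp
  qed
  ultimately show ?thesis by blast
qed

theorem theorem3p9:
  shows "(\<forall>S T :: 'e::banach_lattice \<Rightarrow>\<^sub>L 'f::banach_lattice.
            0 \<le> S \<and> S \<le> T \<and> PL_compact T \<longrightarrow> PL_compact S) \<longleftrightarrow>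
         order_continuous_norm TYPE('e dual) \<or>
         (\<forall>a b :: 'f. abs_weakly_totally_bounded {a..b})"
proof
  assume dom: "\<forall>S T :: 'e \<Rightarrow>\<^sub>L 'f. 0 \<le> S \<and> S \<le> T \<and> PL_compact T \<longrightarrow> PL_compact S"
  show "order_continuous_norm TYPE('e dual) \<or> (\<forall>a b :: 'f. abs_weakly_totally_bounded {a..b})"
  proof (rule ccontr)
    assume neg: "\<not> ?thesis"
    then obtain a b :: 'f where "\<not> abs_weakly_totally_bounded {a..b}" by blast
    with neg obtain S T :: "'e \<Rightarrow>\<^sub>L 'f" where "0 \<le> S \<and> S \<le> T \<and> PL_compact T \<and> \<not> PL_compact S"
      using dominated_not_PL_compact by blast
    then show False using dom by blast
  qed
next
  assume "order_continuous_norm TYPE('e dual) \<or> (\<forall>a b :: 'f. abs_weakly_totally_bounded {a..b})"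
  then show "\<forall>S T :: 'e \<Rightarrow>\<^sub>L 'f. 0 \<le> S \<and> S \<le> T \<and> PL_compact T \<longrightarrow> PL_compact S"
    using dominated_PL_compact_if_dual_norm_order_continuous
      dominated_PL_compact_if_intervals_totally_bounded by blast
qed

end
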